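(* Let $k$ be a field of characteristic $p>0$. Suppose that $p$ is odd and $d$ is even with $p>d$. For very general choices of a homogeneous polynomial $f\in k[x,y,z]$ of degree $d$ and any $q=p^e$ (with $e\ge1$), the Hilbert–Kunz function of $R=k[x,y,z]/(f)$ is given by $$HK(q)=\frac34\,d\,q^2-\frac1{12}(d^3-d).$$
   Context: $HK(q)=\dim_k R/\mathfrak m^{[q]}$, where $\mathfrak m$ is the homogeneous maximal ideal of the standard graded ring $R$ and $\mathfrak m^{[q]}=(x^q,y^q,z^q)R$. A statement holds for a ''very general'' $f$ of degree $d$ if there is a countable collection of Zariski open subsets of the affine space of coefficients of degree-$d$ forms in $k[x,y,z]$ whose intersection is nonempty, such that the statement holds for every $f$ whose coefficients lie in that intersection. Throughout, $f$ is a nonzero homogeneous polynomial in $(x,y,z)^2$. *)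

theory Defs
  imports
    "HOL-Algebra.QuotRing"
    "HOL-Algebra.Embedded_Algebras"
    "HOL-Algebra.Algebraic_Closure_Type"
    "HOL-Library.Poly_Mapping"
    "HOL-Library.Numeral_Type"
    "HOL-Library.Countable_Set"
begin

text \<open>
  Polynomials over \<open>'k\<close> with variables indexed by \<open>'v\<close> are finitely supported functions from
  exponent vectors to coefficients; the multiplication on this type is convolution.
  The polynomial ring \<open>k[x,y,z]\<close> is the case where \<open>'v\<close> is the three-element type \<open>3\<close>,
  with \<open>x\<close>, \<open>y\<close>, \<open>z\<close> the variables of index \<open>0\<close>, \<open>1\<close>, \<open>2\<close>.
\<close>

type_synonym ('v, 'k) mpoly = "('v \<Rightarrow>\<^sub>0 nat) \<Rightarrow>\<^sub>0 'k"

type_synonym 'k poly3 = "(3, 'k) mpoly"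

definition Const :: "'k \<Rightarrow> ('v, 'k::field) mpoly"
  where "Const c = Poly_Mapping.single 0 c"

definition Var :: "'v \<Rightarrow> ('v, 'k::field) mpoly"
  where "Var i = Poly_Mapping.single (Poly_Mapping.single i 1) 1"

definition eval_mpoly :: "('v \<Rightarrow> 'k) \<Rightarrow> ('v, 'k::field) mpoly \<Rightarrow> 'k"
  where "eval_mpoly a g =
    (\<Sum>m\<in>Poly_Mapping.keys g.
      Poly_Mapping.lookup g m *
      (\<Prod>i\<in>Poly_Mapping.keys m. a i ^ Poly_Mapping.lookup m i))"

definition total_degree :: "(3 \<Rightarrow>\<^sub>0 nat) \<Rightarrow> nat"
  where "total_degree m = (\<Sum>i\<in>UNIV. Poly_Mapping.lookup m i)"

text \<open>The zero form belongs to \<open>forms d\<close>, so that it is an affine space over \<open>k\<close>.\<close>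

definition forms :: "nat \<Rightarrow> ('k::field) poly3 set"
  where "forms d = {f. \<forall>m\<in>Poly_Mapping.keys f. total_degree m = d}"

text \<open>
  A Zariski open set is the complement of the common zero set of a set \<open>S\<close> of polynomials in
  the coefficients.  The coordinate of a form \<open>f\<close> with index \<open>m\<close> is the coefficient of the monomial
  with exponent vector \<open>m\<close>.  The polynomials in \<open>S\<close> may formally involve coordinates
  whose index is not of total degree \<open>d\<close>; these vanish on \<open>forms d\<close>.
\<close>

definition zariski_open :: "nat \<Rightarrow> ('k::field) poly3 set \<Rightarrow> bool"
  where "zariski_open d U \<longleftrightarrow>
    (\<exists>S :: (3 \<Rightarrow>\<^sub>0 nat, 'k) mpoly set.
      U = forms d - {f. \<forall>g\<in>S. eval_mpoly (Poly_Mapping.lookup f) g = 0})"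

definition very_general :: "nat \<Rightarrow> (('k::field) poly3 \<Rightarrow> bool) \<Rightarrow> bool"
  where "very_general d P \<longleftrightarrow>
    (\<exists>\<U>. countable \<U> \<and> (\<forall>U\<in>\<U>. zariski_open d U) \<and>
      forms d \<inter> \<Inter>\<U> \<noteq> {} \<and> (\<forall>f \<in> forms d \<inter> \<Inter>\<U>. P f))"

abbreviation poly3_ring :: "('k::field) poly3 ring"
  where "poly3_ring \<equiv> ring_of_type_algebra"

definition curve_ring :: "('k::field) poly3 \<Rightarrow> 'k poly3 set ring"
  where "curve_ring f = poly3_ring Quot (Idl\<^bsub>poly3_ring\<^esub> {f})"

definition curve_proj :: "('k::field) poly3 \<Rightarrow> 'k poly3 \<Rightarrow> 'k poly3 set"
  where "curve_proj f g = (Idl\<^bsub>poly3_ring\<^esub> {f}) +>\<^bsub>poly3_ring\<^esub> g"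

definition bracket_power :: "('k::field) poly3 \<Rightarrow> nat \<Rightarrow> 'k poly3 set set"
  where "bracket_power f q =
    Idl\<^bsub>curve_ring f\<^esub> {curve_proj f (Var i) [^]\<^bsub>curve_ring f\<^esub> q |i. i \<in> UNIV}"

definition bracket_quotient :: "('k::field) poly3 \<Rightarrow> nat \<Rightarrow> 'k poly3 set set ring"
  where "bracket_quotient f q = curve_ring f Quot bracket_power f q"

text \<open>
  The \<open>k\<close>-vector space structure on the quotient is given by multiplication with the classes
  of the constants; \<^const>\<open>ring.dim\<close> expects the field of scalars as a subset of the ring.
\<close>

definition bracket_scalars :: "('k::field) poly3 \<Rightarrow> nat \<Rightarrow> 'k poly3 set set set"
  where "bracket_scalars f q =
    range (\<lambda>c. bracket_power f q +>\<^bsub>curve_ring f\<^esub> curve_proj f (Const c))"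

definition HK :: "('k::field) poly3 \<Rightarrow> nat \<Rightarrow> nat"
  where "HK f q =
    ring.dim (bracket_quotient f q) (bracket_scalars f q) (carrier (bracket_quotient f q))"

end

theory Submission
  imports Defs "Jordan_Normal_Form.Determinant" "HOL-Computational_Algebra.Polynomial"
begin

text \<open>
  Write \<open>d = 2m\<close>, \<open>q = 2h + 1\<close> and \<open>A = k[x,y,z]/(x\<^sup>q,y\<^sup>q,z\<^sup>q)\<close>, a graded algebra whose Hilbert function
  is symmetric about \<open>3h\<close>. If multiplication by a form \<open>f\<close> of degree \<open>d\<close> is bijective from
  \<open>A\<close> in degree \<open>3h - m\<close> to \<open>A\<close> in degree \<open>3h + m\<close>, then it is injective in lower degrees, because the socle of \<open>A\<close>
  lies in degree \<open>6h\<close>, and surjective in higher degrees. So \<open>HK(q)\<close> is the number of monomials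
  of \<open>A\<close> with degree in \<open>[3h - m, 3h + m)\<close>. Bijectivity is the nonvanishing of a determinant in
  the coefficients of \<open>f\<close>, a Zariski open condition for each \<open>q\<close>.

  The form \<open>(xz - y\<^sup>2)\<^sup>m\<close> satisfies these conditions for all \<open>q\<close> at once, which also covers countable
  fields. Multiplication by it preserves the lines \<open>(a + t, b - 2t, c + t)\<close> of exponents
  and acts there as multiplication by \<open>(t - 1)\<^sup>m\<close>. A kernel element gives a multiple of \<open>(t - 1)\<^sup>m\<close>
  with at most \<open>m\<close> nonzero coefficients, at exponents distinct modulo \<open>p\<close>; such a polynomial
  is zero.
\<close>

section \<open>Multiples of a power of \<open>t - 1\<close>\<close>

text \<open>Each operator \<open>t \<cdot> d/dt - a\<close> removes the exponent \<open>a\<close> and lowers the order of vanishing at \<open>1\<close>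
  by at most one.\<close>

lemma poly_eq_0_if_few_coeffs:
  fixes Q :: "'a::idom poly"
  assumes "finite E" "card E \<le> m" "[:-1, 1:] ^ m dvd Q" "\<And>i. coeff Q i \<noteq> 0 \<Longrightarrow> i \<in> E"
    and "inj_on (of_nat :: nat \<Rightarrow> 'a) E"
  shows "Q = 0"
  using assms
proof (induction E arbitrary: m Q rule: finite_induct)
  case empty
  then have "coeff Q i = 0" for i by blast
  then show ?case by (simp add: poly_eq_iff)
next
  case (insert a E)
  define l where "l = ([:-1, 1:] :: 'a poly)"
  obtain n where m: "m = Suc n" and n: "card E \<le> n"
    using insert.prems(1) insert.hyps by (cases m) auto
  obtain P where P: "Q = l ^ Suc n * P"
    using insert.prems(2) unfolding m l_def by (auto elim: dvdE)
  define D where "D = pCons 0 (pderiv Q) - smult (of_nat a) Q"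
  have coeff_D: "coeff D i = (of_nat i - of_nat a) * coeff Q i" for i
    by (cases i) (auto simp: D_def coeff_pCons coeff_pderiv algebra_simps)
  have "pderiv Q = l ^ n * (l * pderiv P + P * smult (of_nat (Suc n)) (pderiv l))"
    by (simp only: P pderiv_mult pderiv_power_Suc) (simp add: algebra_simps)
  then have "l ^ n dvd pderiv Q" by simp
  then have "l ^ n dvd [:0, 1:] * pderiv Q" by (rule dvd_mult)
  moreover have "l ^ n dvd smult (of_nat a) Q"
    unfolding P by (intro dvd_smult dvd_mult2) auto
  ultimately have "l ^ n dvd D" by (simp add: D_def)
  moreover have "coeff D i \<noteq> 0 \<Longrightarrow> i \<in> E" for i
    using insert.prems(3)[of i] by (auto simp: coeff_D)
  ultimately have "D = 0"
    using insert.IH[OF n] insert.prems(4) by (simp add: inj_on_insert l_def)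
  then have zero: "(of_nat i - of_nat a) * coeff Q i = 0" for i
    using coeff_D[of i] by simp
  \<comment> \<open>Injectivity of \<open>of_nat\<close> on the exponents leaves only the exponent
    \<open>a\<close>. The remaining monomial still vanishes at 1, because \<open>Suc n\<close> is
    positive, and its value there is its coefficient.\<close>
  have "coeff Q i = 0" if "i \<noteq> a" for i
  proof (rule ccontr)
    assume "coeff Q i \<noteq> 0"
    then have "i \<in> E" and "(of_nat i :: 'a) = of_nat a"
      using insert.prems(3)[of i] that zero[of i] by auto
    then show False
      using insert.prems(4) that by (auto simp: inj_on_def)
  qed
  then have Q: "Q = monom (coeff Q a) a"
    by (intro poly_eqI) (auto simp: coeff_monom)
  have "poly Q 1 = 0" by (simp add: P l_def)
  then have "coeff Q a = 0" by (subst (asm) Q) (simp add: poly_monom)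
  then show ?case using Q by simp
qed


section \<open>Evaluation of polynomials\<close>

lemma sum_single_lookup:
  "(\<Sum>m\<in>Poly_Mapping.keys g. Poly_Mapping.single m (Poly_Mapping.lookup g m)) = g"
  by (rule poly_mapping_eqI) (auto simp: lookup_sum lookup_single when_def in_keys_iff)

lemma eval_mpoly_superset:
  assumes "finite A" "Poly_Mapping.keys g \<subseteq> A"
  shows "eval_mpoly a g = (\<Sum>m\<in>A. Poly_Mapping.lookup g m *
      (\<Prod>i\<in>Poly_Mapping.keys m. a i ^ Poly_Mapping.lookup m i))"
  unfolding eval_mpoly_def using assms
  by (intro sum.mono_neutral_left) (auto simp: in_keys_iff)

lemma eval_mpoly_add: "eval_mpoly a (g + h) = eval_mpoly a g + eval_mpoly a h"
proof -
  let ?A = "Poly_Mapping.keys g \<union> Poly_Mapping.keys h"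
  have "Poly_Mapping.keys (g + h) \<subseteq> ?A" by (rule keys_add)
  then show ?thesis
    by (simp add: eval_mpoly_superset[of ?A] lookup_add distrib_right sum.distrib)
qed

lemma eval_mpoly_0: "eval_mpoly a 0 = 0"
  by (simp add: eval_mpoly_def)

lemma eval_mpoly_sum: "eval_mpoly a (sum g I) = (\<Sum>i\<in>I. eval_mpoly a (g i))"
  by (induction I rule: infinite_finite_induct) (auto simp: eval_mpoly_0 eval_mpoly_add)

lemma eval_mpoly_single:
  "eval_mpoly a (Poly_Mapping.single m c) =
    c * (\<Prod>i\<in>Poly_Mapping.keys m. a i ^ Poly_Mapping.lookup m i)"
  by (simp add: eval_mpoly_def)

lemma prod_lookup_add:
  fixes m n :: "'v \<Rightarrow>\<^sub>0 nat" and a :: "'v \<Rightarrow> 'k::field"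
  shows "(\<Prod>i\<in>Poly_Mapping.keys (m + n). a i ^ Poly_Mapping.lookup (m + n) i) =
    (\<Prod>i\<in>Poly_Mapping.keys m. a i ^ Poly_Mapping.lookup m i) *
    (\<Prod>i\<in>Poly_Mapping.keys n. a i ^ Poly_Mapping.lookup n i)"
proof -
  let ?A = "Poly_Mapping.keys m \<union> Poly_Mapping.keys n"
  have *: "(\<Prod>i\<in>Poly_Mapping.keys k. a i ^ Poly_Mapping.lookup k i) =
      (\<Prod>i\<in>?A. a i ^ Poly_Mapping.lookup k i)" if "Poly_Mapping.keys k \<subseteq> ?A" for k :: "'v \<Rightarrow>\<^sub>0 nat"
    using that by (intro prod.mono_neutral_left) (auto simp: in_keys_iff)
  show ?thesis
    unfolding *[OF keys_add] *[OF Un_upper1] *[OF Un_upper2]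
    by (simp add: lookup_add power_add prod.distrib)
qed

lemma eval_mpoly_mult: "eval_mpoly a (g * h) = eval_mpoly a g * eval_mpoly a h"
proof -
  have "eval_mpoly a (g * h) = eval_mpoly a
      ((\<Sum>m\<in>Poly_Mapping.keys g. Poly_Mapping.single m (Poly_Mapping.lookup g m)) *
       (\<Sum>n\<in>Poly_Mapping.keys h. Poly_Mapping.single n (Poly_Mapping.lookup h n)))"
    by (simp add: sum_single_lookup)
  also have "\<dots> = eval_mpoly a (\<Sum>m\<in>Poly_Mapping.keys g. Poly_Mapping.single m (Poly_Mapping.lookup g m)) *
      eval_mpoly a (\<Sum>n\<in>Poly_Mapping.keys h. Poly_Mapping.single n (Poly_Mapping.lookup h n))"
    unfolding sum_product eval_mpoly_sum mult_single eval_mpoly_single prod_lookup_add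
    by (simp add: mult_ac)
  finally show ?thesis by (simp add: sum_single_lookup)
qed

lemma eval_mpoly_1: "eval_mpoly a 1 = 1"
  using eval_mpoly_single[of a 0 1] by simp

lemma eval_mpoly_Var: "eval_mpoly a (Var i) = a i"
  by (simp add: Var_def eval_mpoly_single)

text \<open>Evaluation thus commutes with determinants, so the determinant of a matrix of variables
  can serve as the defining polynomial of an open set.\<close>

interpretation eval_mpoly: comm_ring_hom "eval_mpoly a"
  by unfold_locales (auto simp: eval_mpoly_add eval_mpoly_mult eval_mpoly_1 eval_mpoly_0)

section \<open>Multiplication by a form in the monomial bases\<close>

lemma lookup_mult_single:
  fixes f :: "'a::cancel_comm_monoid_add \<Rightarrow>\<^sub>0 'b::semiring_0"
  shows "Poly_Mapping.lookup (f * Poly_Mapping.single N c) M =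
    (if \<exists>L. M = L + N then Poly_Mapping.lookup f (M - N) * c else 0)"
proof -
  have "f * Poly_Mapping.single N c =
      (\<Sum>L\<in>Poly_Mapping.keys f. Poly_Mapping.single (L + N) (Poly_Mapping.lookup f L * c))"
    by (subst sum_single_lookup[of f, symmetric]) (simp add: sum_distrib_right mult_single)
  then have *: "Poly_Mapping.lookup (f * Poly_Mapping.single N c) M =
      (\<Sum>L\<in>Poly_Mapping.keys f. Poly_Mapping.lookup f L * c when L + N = M)"
    by (simp add: lookup_sum lookup_single when_def)
  show ?thesis
  proof (cases "\<exists>L. M = L + N")
    case True
    then obtain L where L: "M = L + N" by blast
    then have "Poly_Mapping.lookup (f * Poly_Mapping.single N c) M =
        (\<Sum>L'\<in>Poly_Mapping.keys f. if L' = L then Poly_Mapping.lookup f L * c else 0)"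
      unfolding * by (intro sum.cong) (auto simp: when_def)
    then show ?thesis using L by (auto simp: in_keys_iff)
  next
    case False
    then show ?thesis unfolding * by (auto simp: when_def intro!: sum.neutral)
  qed
qed

section \<open>Exponent vectors in three variables and matrices of multiplication\<close>

lemma UNIV_3: "(UNIV :: 3 set) = {0, 1, 2}"
proof -
  have "card {0, 1, 2 :: 3} = card (UNIV :: 3 set)" by simp
  then show ?thesis by (intro card_subset_eq[symmetric]) auto
qed

lemma exhaust_3: "i = 0 \<or> i = 1 \<or> i = (2 :: 3)"
  using UNIV_I[of i] unfolding UNIV_3 by simp

lemma all_3: "(\<forall>i::3. P i) \<longleftrightarrow> P 0 \<and> P 1 \<and> P 2"
  using exhaust_3 by metis

lemma total_degree_eq:
  "total_degree M = Poly_Mapping.lookup M 0 + Poly_Mapping.lookup M 1 + Poly_Mapping.lookup M 2"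
  unfolding total_degree_def UNIV_3 by simp

lemma total_degree_add: "total_degree (M + N) = total_degree M + total_degree N"
  by (simp add: total_degree_eq lookup_add)

definition exp3 :: "nat \<Rightarrow> nat \<Rightarrow> nat \<Rightarrow> 3 \<Rightarrow>\<^sub>0 nat"
  where "exp3 a b c = Poly_Mapping.single 0 a + Poly_Mapping.single 1 b + Poly_Mapping.single 2 c"

lemma lookup_exp3 [simp]:
  "Poly_Mapping.lookup (exp3 a b c) 0 = a"
  "Poly_Mapping.lookup (exp3 a b c) 1 = b"
  "Poly_Mapping.lookup (exp3 a b c) 2 = c"
  by (simp_all add: exp3_def lookup_add lookup_single)

lemma exp3_eqI:
  assumes "Poly_Mapping.lookup M 0 = Poly_Mapping.lookup N 0"
    "Poly_Mapping.lookup M 1 = Poly_Mapping.lookup N 1"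
    "Poly_Mapping.lookup M (2::3) = Poly_Mapping.lookup N 2"
  shows "M = N"
proof (rule poly_mapping_eqI)
  fix i :: 3
  show "Poly_Mapping.lookup M i = Poly_Mapping.lookup N i"
    using assms exhaust_3[of i] by auto
qed

lemma exp3_lookup: "exp3 (Poly_Mapping.lookup M 0) (Poly_Mapping.lookup M 1) (Poly_Mapping.lookup M 2) = M"
  by (rule exp3_eqI) auto

lemma total_degree_exp3 [simp]: "total_degree (exp3 a b c) = a + b + c"
  by (simp add: total_degree_eq)

text \<open>The monomials outside (x^q, y^q, z^q), that is, the monomial basis of
  k[x,y,z]/(x^q,y^q,z^q).\<close>

definition box :: "nat \<Rightarrow> (3 \<Rightarrow>\<^sub>0 nat) set"
  where "box q = {M. \<forall>i. Poly_Mapping.lookup M i < q}"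

definition box_deg :: "nat \<Rightarrow> nat \<Rightarrow> (3 \<Rightarrow>\<^sub>0 nat) set"
  where "box_deg q n = {M \<in> box q. total_degree M = n}"

lemma box_iff:
  "M \<in> box q \<longleftrightarrow> Poly_Mapping.lookup M 0 < q \<and> Poly_Mapping.lookup M 1 < q \<and> Poly_Mapping.lookup M 2 < q"
  by (simp add: box_def all_3)

lemma box_eq: "box q = (\<lambda>(a, b, c). exp3 a b c) ` ({..<q} \<times> {..<q} \<times> {..<q})"
proof
  show "box q \<subseteq> (\<lambda>(a, b, c). exp3 a b c) ` ({..<q} \<times> {..<q} \<times> {..<q})"
  proof
    fix M assume "M \<in> box q"
    then show "M \<in> (\<lambda>(a, b, c). exp3 a b c) ` ({..<q} \<times> {..<q} \<times> {..<q})"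
      by (intro image_eqI[of _ _ "(Poly_Mapping.lookup M 0, Poly_Mapping.lookup M 1, Poly_Mapping.lookup M 2)"])
        (auto simp: box_iff exp3_lookup)
  qed
qed (auto simp: box_iff)

lemma finite_box [simp]: "finite (box q)"
  by (simp add: box_eq)

lemma finite_box_deg [simp]: "finite (box_deg q n)"
  by (simp add: box_deg_def)

text \<open>The matrix entry of multiplication by \<open>f\<close> in the monomial basis. The guard
  tests divisibility of monomials, since \<open>M - N\<close> is truncated.\<close>

definition mult_coeff :: "'k::field poly3 \<Rightarrow> (3 \<Rightarrow>\<^sub>0 nat) \<Rightarrow> (3 \<Rightarrow>\<^sub>0 nat) \<Rightarrow> 'k"
  where "mult_coeff f M N = (if \<exists>L. M = L + N then Poly_Mapping.lookup f (M - N) else 0)"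

lemma lookup_mult_keys:
  fixes f u :: "'k::field poly3"
  assumes "finite Y" "Poly_Mapping.keys u \<subseteq> Y"
  shows "Poly_Mapping.lookup (f * u) M = (\<Sum>N\<in>Y. mult_coeff f M N * Poly_Mapping.lookup u N)"
proof -
  have "Poly_Mapping.lookup (f * u) M =
      (\<Sum>N\<in>Poly_Mapping.keys u. mult_coeff f M N * Poly_Mapping.lookup u N)"
    by (subst sum_single_lookup[of u, symmetric], unfold sum_distrib_left lookup_sum)
      (rule sum.cong, auto simp: lookup_mult_single mult_coeff_def)
  also have "\<dots> = (\<Sum>N\<in>Y. mult_coeff f M N * Poly_Mapping.lookup u N)"
    using assms by (intro sum.mono_neutral_left) (auto simp: in_keys_iff)
  finally show ?thesis .
qed

lemma mult_coeff_forms: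
  assumes "f \<in> forms d" "mult_coeff f M N \<noteq> 0"
  shows "total_degree M = total_degree N + d"
proof -
  obtain L where L: "M = L + N" "Poly_Mapping.lookup f L \<noteq> 0"
    using assms(2) by (auto simp: mult_coeff_def split: if_splits)
  then have "total_degree L = d"
    using assms(1) by (auto simp: forms_def in_keys_iff)
  then show ?thesis using L by (simp add: total_degree_add)
qed

text \<open>Divisors of a monomial in the box lie in the box, and degrees add. So only basis
  monomials of degree \<open>n\<close> contribute, whatever other terms \<open>u\<close>
  has.\<close>

lemma lookup_mult_box_deg:
  fixes f u :: "'k::field poly3"
  assumes f: "f \<in> forms d" and M: "M \<in> box_deg q (n + d)"
  shows "Poly_Mapping.lookup (f * u) M =
    (\<Sum>N\<in>box_deg q n. mult_coeff f M N * Poly_Mapping.lookup u N)"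
proof -
  have "Poly_Mapping.lookup (f * u) M =
      (\<Sum>N\<in>Poly_Mapping.keys u \<union> box_deg q n. mult_coeff f M N * Poly_Mapping.lookup u N)"
    by (rule lookup_mult_keys) auto
  also have "\<dots> = (\<Sum>N\<in>box_deg q n. mult_coeff f M N * Poly_Mapping.lookup u N)"
  proof (intro sum.mono_neutral_right ballI)
    fix N assume N: "N \<in> Poly_Mapping.keys u \<union> box_deg q n - box_deg q n"
    have "N \<in> box_deg q n" if nz: "mult_coeff f M N \<noteq> 0"
      using mult_coeff_forms[OF f nz] M nz
      by (auto simp: mult_coeff_def box_deg_def box_iff lookup_add split: if_splits)
    then show "mult_coeff f M N * Poly_Mapping.lookup u N = 0"
      using N by auto
  qed auto
  finally show ?thesis .
qed

text \<open>Injectivity on k[x,y,z]/(x^q,y^q,z^q) from degree \<open>n\<close> to degree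
  \<open>n'\<close>, phrased with coefficient vectors so that it speaks of the kernel of a matrix. A
  separate \<open>n'\<close> allows the symmetric degrees \<open>3 * h - m\<close> and
  \<open>3 * h + m\<close>.\<close>

definition mult_inj :: "'k::field poly3 \<Rightarrow> nat \<Rightarrow> nat \<Rightarrow> nat \<Rightarrow> bool"
  where "mult_inj f q n n' \<longleftrightarrow>
    (\<forall>v. (\<forall>M\<in>box_deg q n'. (\<Sum>N\<in>box_deg q n. mult_coeff f M N * v N) = 0) \<longrightarrow>
      (\<forall>N\<in>box_deg q n. v N = 0))"

section \<open>Products of forms\<close>

lemma forms_mult:
  assumes "f \<in> forms a" "g \<in> forms b"
  shows "f * g \<in> forms (a + b)"
  using assms keys_mult[of f g] by (fastforce simp: forms_def total_degree_add)

lemma forms_one: "(1 :: 'k::field poly3) \<in> forms 0"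
  by (auto simp: forms_def total_degree_eq)

lemma forms_power: "f \<in> forms a \<Longrightarrow> f ^ n \<in> forms (a * n)"
  by (induction n) (auto simp: forms_one dest: forms_mult)

lemma forms_diff: "f \<in> forms a \<Longrightarrow> g \<in> forms a \<Longrightarrow> f - g \<in> forms a"
  by (auto simp: forms_def in_keys_iff lookup_minus)

lemma forms_Var: "(Var i :: 'k::field poly3) \<in> forms 1"
  by (auto simp: forms_def Var_def total_degree_def lookup_single when_def)

section \<open>Powers of a conic\<close>

definition conic :: "'k::field poly3"
  where "conic = Var 0 * Var 2 - Var 1 ^ 2"

lemma conic_forms: "(conic :: 'k::field poly3) \<in> forms 2"
  unfolding conic_def power2_eq_square
  using forms_mult[OF forms_Var forms_Var] by (intro forms_diff) (simp_all add: numeral_2_eq_2)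

text \<open>With integer exponents and the value 0 at negative ones, multiplication by a variable is
  a plain shift without boundary cases.\<close>

definition icoeff :: "'k::field poly3 \<Rightarrow> int \<Rightarrow> int \<Rightarrow> int \<Rightarrow> 'k"
  where "icoeff u i j k =
    (if i \<ge> 0 \<and> j \<ge> 0 \<and> k \<ge> 0 then Poly_Mapping.lookup u (exp3 (nat i) (nat j) (nat k)) else 0)"

lemma icoeff_diff: "icoeff (f - g) i j k = icoeff f i j k - icoeff g i j k"
  by (simp add: icoeff_def lookup_minus)

lemma lookup_mult_Var:
  fixes u :: "'k::field poly3"
  shows "Poly_Mapping.lookup (Var v * u) M =
    (if Poly_Mapping.lookup M v = 0 then 0 else Poly_Mapping.lookup u (M - Poly_Mapping.single v 1))"
proof -
  have "(\<exists>L. M = L + Poly_Mapping.single v 1) \<longleftrightarrow> Poly_Mapping.lookup M v \<noteq> 0"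
  proof
    assume "Poly_Mapping.lookup M v \<noteq> 0"
    then have "M = (M - Poly_Mapping.single v 1) + Poly_Mapping.single v 1"
      by (intro poly_mapping_eqI) (auto simp: lookup_add lookup_minus lookup_single when_def)
    then show "\<exists>L. M = L + Poly_Mapping.single v 1" by blast
  qed (auto simp: lookup_add)
  then show ?thesis
    by (simp add: Var_def mult.commute[of _ u] lookup_mult_single)
qed

lemma exp3_minus_single:
  "exp3 a b c - Poly_Mapping.single 0 1 = exp3 (a - 1) b c"
  "exp3 a b c - Poly_Mapping.single 1 1 = exp3 a (b - 1) c"
  "exp3 a b c - Poly_Mapping.single 2 1 = exp3 a b (c - 1)"
  by (rule exp3_eqI; simp add: lookup_minus lookup_single)+

lemma icoeff_Var:
  "icoeff (Var 0 * u) i j k = icoeff u (i - 1) j k"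
  "icoeff (Var 1 * u) i j k = icoeff u i (j - 1) k"
  "icoeff (Var 2 * u) i j k = icoeff u i j (k - 1)"
  by (auto simp: icoeff_def lookup_mult_Var exp3_minus_single[simplified] nat_diff_distrib)

lemma icoeff_conic_mult:
  "icoeff (conic * u) i j k = icoeff u (i - 1) j (k - 1) - icoeff u i (j - 2) k"
  by (simp add: conic_def power2_eq_square left_diff_distrib icoeff_diff mult.assoc icoeff_Var)

text \<open>The generating polynomial of the coefficients of \<open>u\<close> along a line of
  exponents. Stopping at \<open>t = B\<close> loses nothing, because the middle exponent is negative
  beyond.\<close>

definition line_poly :: "nat \<Rightarrow> nat \<Rightarrow> nat \<Rightarrow> 'k::field poly3 \<Rightarrow> 'k poly"
  where "line_poly A B C u =
    (\<Sum>t\<le>B. monom (icoeff u (int A + int t) (int B - 2 * int t) (int C + int t)) t)"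

lemma coeff_line_poly:
  "coeff (line_poly A B C u) t = icoeff u (int A + int t) (int B - 2 * int t) (int C + int t)"
proof (cases "t \<le> B")
  case False
  then show ?thesis
    by (auto simp: line_poly_def coeff_sum coeff_monom icoeff_def intro!: sum.neutral)
qed (simp add: line_poly_def coeff_sum coeff_monom)

text \<open>Relative to the new base point, multiplication by xz raises \<open>t\<close> by one and
  multiplication by y^2 keeps it. The hypothesis puts the base point at the edge, so that no term of
  \<open>u\<close> with \<open>t = -1\<close> could contribute at \<open>t = 0\<close>.\<close>

lemma line_poly_conic_mult:
  fixes u :: "'k::field poly3"
  assumes "A = 0 \<or> C = 0"
  shows "line_poly A (B + 2) C (conic * u) = [:-1, 1:] * line_poly A B C u"
proof (rule poly_eqI)
  fix t
  show "coeff (line_poly A (B + 2) C (conic * u)) t = coeff ([:-1, 1:] * line_poly A B C u) t"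
  proof (cases t)
    case 0
    have "icoeff u (int A - 1) j (int C - 1) = 0" for j
      using assms by (auto simp: icoeff_def)
    then show ?thesis
      by (simp add: 0 coeff_line_poly icoeff_conic_mult)
  qed (simp add: coeff_line_poly icoeff_conic_mult algebra_simps)
qed

lemma line_poly_conic_power_mult:
  fixes u :: "'k::field poly3"
  assumes "A = 0 \<or> C = 0"
  shows "line_poly A (B + 2 * m) C (conic ^ m * u) = [:-1, 1:] ^ m * line_poly A B C u"
proof (induction m)
  case (Suc m)
  have "line_poly A (B + 2 * Suc m) C (conic ^ Suc m * u) =
      line_poly A ((B + 2 * m) + 2) C (conic * (conic ^ m * u))"
    by (simp add: mult.assoc)
  then show ?case
    by (simp only: line_poly_conic_mult[OF assms] Suc.IH power_Suc mult.assoc)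
qed simp

lemma coeff_linear_power_mult_nonzero:
  fixes P :: "'a::idom poly"
  assumes "coeff ([:-1, 1:] ^ m * P) i \<noteq> 0"
  obtains t where "t \<le> m" "t \<le> i" "coeff P (i - t) \<noteq> 0"
proof -
  have "(\<Sum>t\<le>i. coeff ([:-1, 1:] ^ m) t * coeff P (i - t)) \<noteq> 0"
    using assms by (simp add: coeff_mult)
  then obtain t where t: "t \<le> i" "coeff ([:-1, 1:] ^ m :: 'a poly) t * coeff P (i - t) \<noteq> 0"
    by (auto elim: sum.not_neutral_contains_not_neutral)
  moreover have "t \<le> m"
    using t(2) le_degree[of "[:-1, 1:] ^ m :: 'a poly" t] degree_linear_power[of "-1::'a" m] by auto
  ultimately show thesis using that by auto
qed

text \<open>Separates exponents in \<open>'k\<close> even if they differ by more than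
  \<open>p\<close>, as long as the difference avoids the multiples of \<open>p\<close>.\<close>

lemma of_nat_neq_if_diff_between_multiples:
  assumes "CHAR('k::field) = p" "x < y" "p * s < y - x" "y - x < p * s + p"
  shows "(of_nat x :: 'k) \<noteq> of_nat y"
proof
  assume "(of_nat x :: 'k) = of_nat y"
  then have "(of_nat (y - x) :: 'k) = 0"
    using assms(2) by (simp add: of_nat_diff)
  then have "p dvd y - x"
    using assms(1) by (simp add: of_nat_eq_0_iff_char_dvd)
  then obtain r where r: "y - x = p * r" by blast
  have "p * s < p * r" "p * r < p * Suc s" using assms r by simp_all
  then have "s < r" "r < Suc s" by (auto simp only: mult_less_cancel1)
  then show False by simp
qed

text \<open>Here \<open>2\<beta> + \<epsilon>\<close> and \<open>j\<close> are the numbers \<open>B\<close> and \<open>A + C\<close> of a line of exponents. The hypotheses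
  on \<open>i\<close> and \<open>t\<close> say that the point \<open>i - t\<close> of the line in degree \<open>3h - m\<close> is the exponent of a
  monomial not in \<open>(x\<^sup>q, y\<^sup>q, z\<^sup>q)\<close>, and that the point \<open>i\<close> of the line in degree \<open>3h + m\<close> is not.\<close>

lemma line_exponents_few:
  fixes h m j \<beta> \<epsilon> :: nat
  assumes "\<epsilon> \<le> 1" "2 * \<beta> + \<epsilon> + m + j = 3 * h" "m \<le> h" "0 < m"
  obtains E where "finite E" "card E \<le> m"
    "\<And>i t. \<lbrakk>t \<le> m; t \<le> i; j + (i - t) \<le> 2 * h; 2 * (i - t) \<le> 2 * \<beta> + \<epsilon>;
        2 * \<beta> + \<epsilon> \<le> 2 * h + 2 * (i - t);
        \<not> (j + i \<le> 2 * h \<and> 2 * i \<le> 2 * \<beta> + \<epsilon> + 2 * m \<and> 2 * \<beta> + \<epsilon> + 2 * m \<le> 2 * h + 2 * i)\<rbrakk>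
      \<Longrightarrow> i \<in> E"
    "\<And>x y. \<lbrakk>x \<in> E; y \<in> E; x < y\<rbrakk> \<Longrightarrow> y - x < m \<or> h + 2 \<le> y - x + m \<and> y - x < h + m"
proof (cases "h \<le> \<beta> + \<epsilon>")
  case True
  \<comment> \<open>The bound \<open>2 * h\<close> on the middle exponent makes \<open>?s\<close>
    the least parameter in the lower degree and \<open>?s + m\<close> in the upper one. The largest
    parameter rises from \<open>\<beta>\<close> to \<open>\<beta> + m\<close>, so products leave the
    box only at the bottom.\<close>
  let ?s = "\<beta> + \<epsilon> - h"
  show thesis
  proof (rule that[of "{?s..<?s + m}"])
    fix i t assume *: "t \<le> m" "t \<le> i" "j + (i - t) \<le> 2 * h" "2 * (i - t) \<le> 2 * \<beta> + \<epsilon>"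
      "2 * \<beta> + \<epsilon> \<le> 2 * h + 2 * (i - t)"
      "\<not> (j + i \<le> 2 * h \<and> 2 * i \<le> 2 * \<beta> + \<epsilon> + 2 * m \<and> 2 * \<beta> + \<epsilon> + 2 * m \<le> 2 * h + 2 * i)"
    obtain r where r: "i = r + t" using *(2) by (metis le_add_diff_inverse2)
    show "i \<in> {?s..<?s + m}"
      using * assms True unfolding r by simp arith
  qed auto
next
  case False
  show thesis
  proof (cases "\<beta> + \<epsilon> + m \<le> h")
    case True
    \<comment> \<open>Here the outer exponents give the same upper bound \<open>?s\<close> in both
      degrees and nothing is lost at the bottom, so products leave the box only at the top, by at
      most \<open>m\<close>.\<close>
    let ?s = "2 * h - j"
    show thesis
    proof (rule that[of "{?s + 1..<?s + 1 + m}"])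
      fix i t assume *: "t \<le> m" "t \<le> i" "j + (i - t) \<le> 2 * h" "2 * (i - t) \<le> 2 * \<beta> + \<epsilon>"
        "2 * \<beta> + \<epsilon> \<le> 2 * h + 2 * (i - t)"
        "\<not> (j + i \<le> 2 * h \<and> 2 * i \<le> 2 * \<beta> + \<epsilon> + 2 * m \<and> 2 * \<beta> + \<epsilon> + 2 * m \<le> 2 * h + 2 * i)"
      obtain r where r: "i = r + t" using *(2) by (metis le_add_diff_inverse2)
      show "i \<in> {?s + 1..<?s + 1 + m}"
        using * assms True unfolding r by simp arith
    qed auto
  next
    case False': False
    \<comment> \<open>Both ends lose exponents: \<open>?s\<close> at the bottom and
      \<open>m - ?s\<close> at the top. Exponents from different ends differ by at least
      \<open>\<beta> + 2\<close> and at most \<open>\<beta> + m\<close>, where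
      \<open>h - m \<le> \<beta> < h\<close>.\<close>
    let ?s = "\<beta> + \<epsilon> + m - h"
    let ?E = "{..<?s} \<union> {\<beta> + ?s + 1..<\<beta> + m + 1}"
    have "card ?E \<le> card {..<?s} + card {\<beta> + ?s + 1..<\<beta> + m + 1}"
      by (rule card_Un_le)
    also have "\<dots> \<le> m" using False False' by simp
    finally have card: "card ?E \<le> m" .
    show thesis
    proof (rule that[of ?E])
      fix i t assume *: "t \<le> m" "t \<le> i" "j + (i - t) \<le> 2 * h" "2 * (i - t) \<le> 2 * \<beta> + \<epsilon>"
        "2 * \<beta> + \<epsilon> \<le> 2 * h + 2 * (i - t)"
        "\<not> (j + i \<le> 2 * h \<and> 2 * i \<le> 2 * \<beta> + \<epsilon> + 2 * m \<and> 2 * \<beta> + \<epsilon> + 2 * m \<le> 2 * h + 2 * i)"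
      obtain r where r: "i = r + t" using *(2) by (metis le_add_diff_inverse2)
      show "i \<in> ?E"
        using * assms False False' unfolding r by simp arith
    next
      fix x y assume "x \<in> ?E" "y \<in> ?E" "x < y"
      then show "y - x < m \<or> h + 2 \<le> y - x + m \<and> y - x < h + m"
        using assms False False' by simp arith
    qed (use card in auto)
  qed
qed

text \<open>The base exponent \<open>(A, B, C)\<close> of the line through \<open>N\<close> is chosen with \<open>min A C = 0\<close>, so that
  no exponent of the line precedes it.\<close>

lemma mult_inj_conic_power:
  fixes p h m :: nat
  assumes char: "CHAR('k::field) = p" and h: "h mod p = (p - 1) div 2" and p: "odd p"
    and m: "0 < m" "2 * m < p"
  shows "mult_inj (conic ^ m :: 'k poly3) (2 * h + 1) (3 * h - m) (3 * h + m)"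
  unfolding mult_inj_def
proof (intro allI impI ballI)
  define q where "q = 2 * h + 1"
  fix v :: "(3 \<Rightarrow>\<^sub>0 nat) \<Rightarrow> 'k" and N
  assume v: "\<forall>M\<in>box_deg (2 * h + 1) (3 * h + m).
      (\<Sum>N\<in>box_deg (2 * h + 1) (3 * h - m). mult_coeff (conic ^ m) M N * v N) = 0"
    and N: "N \<in> box_deg (2 * h + 1) (3 * h - m)"
  have mh: "m \<le> h"
    using mod_less_eq_dividend[of h p] h m(2) by simp
  define u where "u = (\<Sum>N\<in>box_deg q (3 * h - m). Poly_Mapping.single N (v N))"
  have lookup_u: "Poly_Mapping.lookup u N = (if N \<in> box_deg q (3 * h - m) then v N else 0)" for N
    by (simp add: u_def lookup_sum lookup_single when_def)
  have conic_m: "(conic ^ m :: 'k poly3) \<in> forms (2 * m)"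
    by (intro forms_power conic_forms)
  have prod0: "Poly_Mapping.lookup (conic ^ m * u) M = 0" if "M \<in> box_deg q (3 * h + m)" for M
  proof -
    have "3 * h - m + 2 * m = 3 * h + m" using mh by simp
    then have M: "M \<in> box_deg q (3 * h - m + 2 * m)" using that by (simp only:)
    show ?thesis
      unfolding lookup_mult_box_deg[OF conic_m M] using v that by (simp add: lookup_u q_def)
  qed
  define a b c where abc: "a = Poly_Mapping.lookup N 0" "b = Poly_Mapping.lookup N 1"
    "c = Poly_Mapping.lookup N 2"
  have N': "a < q" "b < q" "c < q" "a + b + c = 3 * h - m"
    using N by (auto simp: abc box_deg_def box_iff total_degree_eq q_def)
  define k where "k = min a c"
  define A B C where ABC: "A = a - k" "B = b + 2 * k" "C = c - k"
  \<comment> \<open>As \<open>A\<close> or \<open>C\<close> is zero, \<open>j\<close> is the larger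
    of the two, and the single bound \<open>j + i \<le> 2 * h\<close> controls both outer
    exponents.\<close>
  define j where "j = A + C"
  have AC: "A = 0 \<or> C = 0" by (auto simp: ABC k_def)
  have sum: "B + m + j = 3 * h" using N'(4) mh by (auto simp: ABC k_def j_def min_def)
  define P where "P = line_poly A B C u"
  define Q where "Q = line_poly A (B + 2 * m) C (conic ^ m * u)"
  have Q: "Q = [:-1, 1:] ^ m * P"
    unfolding Q_def P_def by (rule line_poly_conic_power_mult[OF AC])
  have coeff_P: "j + i \<le> 2 * h \<and> 2 * i \<le> B \<and> B \<le> 2 * h + 2 * i" if "coeff P i \<noteq> 0" for i
  proof -
    have "2 * i \<le> B" "exp3 (A + i) (B - 2 * i) (C + i) \<in> box q"
      using that by (auto simp: P_def coeff_line_poly icoeff_def lookup_u box_deg_def nat_add_distrib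
        nat_diff_distrib nat_mult_distrib split: if_splits)
    then show ?thesis using AC by (auto simp: box_iff q_def j_def)
  qed
  \<comment> \<open>The product vanishes on the box in degree \<open>3 * h + m\<close>, so
    \<open>Q\<close> lives only where the line has left the box.\<close>
  have coeff_Q: "\<not> (j + i \<le> 2 * h \<and> 2 * i \<le> B + 2 * m \<and> B + 2 * m \<le> 2 * h + 2 * i)"
    if "coeff Q i \<noteq> 0" for i
  proof
    assume *: "j + i \<le> 2 * h \<and> 2 * i \<le> B + 2 * m \<and> B + 2 * m \<le> 2 * h + 2 * i"
    have "exp3 (A + i) (B + 2 * m - 2 * i) (C + i) \<in> box_deg q (3 * h + m)"
      using * sum by (auto simp: box_deg_def box_iff q_def j_def)
    then have "coeff Q i = 0"
      using prod0 * by (simp add: Q_def coeff_line_poly icoeff_def nat_add_distrib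
        nat_diff_distrib nat_mult_distrib)
    then show False using that by simp
  qed
  obtain \<beta> \<epsilon> where B: "B = 2 * \<beta> + \<epsilon>" "\<epsilon> \<le> 1"
    by (rule that[of "B div 2" "B mod 2"]) auto
  have sum': "2 * \<beta> + \<epsilon> + m + j = 3 * h" using sum B by simp
  obtain E where E: "finite E" "card E \<le> m"
    and supp: "\<And>i t. \<lbrakk>t \<le> m; t \<le> i; j + (i - t) \<le> 2 * h; 2 * (i - t) \<le> 2 * \<beta> + \<epsilon>;
        2 * \<beta> + \<epsilon> \<le> 2 * h + 2 * (i - t);
        \<not> (j + i \<le> 2 * h \<and> 2 * i \<le> 2 * \<beta> + \<epsilon> + 2 * m \<and> 2 * \<beta> + \<epsilon> + 2 * m \<le> 2 * h + 2 * i)\<rbrakk>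
      \<Longrightarrow> i \<in> E"
    and diff: "\<And>x y. \<lbrakk>x \<in> E; y \<in> E; x < y\<rbrakk> \<Longrightarrow> y - x < m \<or> h + 2 \<le> y - x + m \<and> y - x < h + m"
    by (rule line_exponents_few[OF B(2) sum' mh m(1)]) (rule that)
  have "Q = 0"
  proof (rule poly_eq_0_if_few_coeffs[OF E])
    show "[:-1, 1:] ^ m dvd Q" by (simp add: Q)
    show "i \<in> E" if "coeff Q i \<noteq> 0" for i
    proof -
      obtain t where t: "t \<le> m" "t \<le> i" "coeff P (i - t) \<noteq> 0"
        using \<open>coeff Q i \<noteq> 0\<close> unfolding Q by (rule coeff_linear_power_mult_nonzero)
      show ?thesis
        using supp[OF t(1,2)] coeff_P[OF t(3)] coeff_Q[OF that] B(1) by blast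
    qed
    \<comment> \<open>Exponents at the same end of the line differ by less than \<open>m\<close>.
      Those at opposite ends differ from each other by \<open>h\<close> up to an error below
      \<open>m \<le> r\<close>; as \<open>h\<close> is \<open>r\<close> above a multiple of
      \<open>p\<close>, such a difference falls strictly between two consecutive multiples.\<close>
    have neq: "(of_nat x :: 'k) \<noteq> of_nat y" if xy: "x \<in> E" "y \<in> E" "x < y" for x y
    proof -
      define r where "r = (p - 1) div 2"
      have p': "p = 2 * r + 1" using p by (auto simp: r_def elim: oddE)
      have hr: "h = p * (h div p) + r" using h by (metis mult_div_mod_eq r_def)
      have "m \<le> r" using m(2) p' by simp
      from diff[OF xy] show ?thesis
      proof
        assume "y - x < m"
        then show ?thesis
          using m(2) xy(3) by (intro of_nat_neq_if_diff_between_multiples[OF char, of _ _ 0]) auto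
      next
        assume "h + 2 \<le> y - x + m \<and> y - x < h + m"
        then show ?thesis
          using hr p' \<open>m \<le> r\<close> xy(3)
          by (intro of_nat_neq_if_diff_between_multiples[OF char, of _ _ "h div p"]) linarith+
      qed
    qed
    show "inj_on (of_nat :: nat \<Rightarrow> 'k) E"
    proof (rule inj_onI)
      fix x y assume "x \<in> E" "y \<in> E" "(of_nat x :: 'k) = of_nat y"
      then show "x = y" using neq[of x y] neq[of y x] by (cases x y rule: linorder_cases) auto
    qed
  qed
  then have "P = 0" using Q by simp
  \<comment> \<open>\<open>N\<close> is the point with parameter \<open>k\<close> on its
    line.\<close>
  then have "icoeff u (int A + int k) (int B - 2 * int k) (int C + int k) = 0"
    using coeff_line_poly[of A B C u k] by (simp add: P_def)
  moreover have "int A + int k = int a" "int B - 2 * int k = int b" "int C + int k = int c"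
    by (auto simp: ABC k_def)
  ultimately have "Poly_Mapping.lookup u N = 0"
    by (simp add: icoeff_def abc exp3_lookup)
  then show "v N = 0" using N by (simp add: lookup_u q_def)
qed

section \<open>Counting monomials\<close>

lemma double_sum_lessThan_plus:
  fixes k :: int
  shows "2 * (\<Sum>i<n. k + int i) = int n * (2 * k + int n - 1)"
  by (induction n) (auto simp: algebra_simps)

lemma double_sum_lessThan_minus:
  fixes k :: int
  shows "2 * (\<Sum>i<n. k - int i) = int n * (2 * k - int n + 1)"
  by (induction n) (auto simp: algebra_simps)

text \<open>For a fixed first exponent \<open>a\<close> the second exponents form an interval, whose
  length grows up to \<open>a = s - 2 * h\<close> and shrinks afterwards. Summing the two arithmetic
  series gives a quadratic in \<open>s\<close>, symmetric about \<open>3 * h\<close>; the symmetry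
  makes the multiplication matrix square.\<close>

lemma card_box_deg:
  assumes "2 * h \<le> s" "s \<le> 4 * h"
  shows "int (card (box_deg (2 * h + 1) s)) = 3 * (int h)\<^sup>2 + 3 * int h + 1 - (int s - 3 * int h)\<^sup>2"
proof -
  define w where "w = s - 2 * h"
  have s: "s = 2 * h + w" "w \<le> 2 * h" using assms by (auto simp: w_def)
  define F where "F a = {b. b \<le> 2 * h \<and> a + b \<le> s \<and> s \<le> 2 * h + a + b}" for a
  have "bij_betw (\<lambda>(a, b). exp3 a b (s - a - b)) (Sigma {..2 * h} F) (box_deg (2 * h + 1) s)"
  proof (rule bij_betw_byWitness[where f' = "\<lambda>M. (Poly_Mapping.lookup M 0, Poly_Mapping.lookup M 1)"])
    show "\<forall>M\<in>box_deg (2 * h + 1) s. (case (Poly_Mapping.lookup M 0, Poly_Mapping.lookup M 1) of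
        (a, b) \<Rightarrow> exp3 a b (s - a - b)) = M"
      by (auto simp: box_deg_def total_degree_eq intro!: exp3_eqI)
    show "(\<lambda>(a, b). exp3 a b (s - a - b)) ` Sigma {..2 * h} F \<subseteq> box_deg (2 * h + 1) s"
      by (auto simp: box_deg_def box_iff F_def)
    show "(\<lambda>M. (Poly_Mapping.lookup M 0, Poly_Mapping.lookup M 1)) ` box_deg (2 * h + 1) s
        \<subseteq> Sigma {..2 * h} F"
      by (auto simp: box_deg_def box_iff F_def total_degree_eq)
  qed auto
  then have "card (box_deg (2 * h + 1) s) = card (Sigma {..2 * h} F)"
    by (simp add: bij_betw_same_card)
  also have "\<dots> = (\<Sum>a\<le>2 * h. card (F a))"
    by (rule card_SigmaI) (auto simp: F_def)
  also have "{..2 * h} = {..<w + 1} \<union> {w + 1..<2 * h + 1}" using s by auto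
  also have "(\<Sum>a\<in>{..<w + 1} \<union> {w + 1..<2 * h + 1}. card (F a)) =
      (\<Sum>a<w + 1. card (F a)) + (\<Sum>a=w + 1..<2 * h + 1. card (F a))"
    by (rule sum.union_disjoint) auto
  also have "(\<Sum>a=w + 1..<2 * h + 1. card (F a)) = (\<Sum>i<2 * h - w. card (F (i + (w + 1))))"
    using sum.shift_bounds_nat_ivl[of "\<lambda>a. card (F a)" 0 "w + 1" "2 * h - w"] s
    by (simp add: lessThan_atLeast0)
  finally have card: "int (card (box_deg (2 * h + 1) s)) =
      (\<Sum>a<w + 1. int (card (F a))) + (\<Sum>i<2 * h - w. int (card (F (i + (w + 1)))))"
    by simp
  have "(\<Sum>a<w + 1. int (card (F a))) = (\<Sum>a<w + 1. (2 * int h + 1 - int w) + int a)"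
  proof (rule sum.cong)
    fix a assume "a \<in> {..<w + 1}"
    then have "F a = {w - a..2 * h}" "w - a \<le> 2 * h" "a \<le> w" using s by (auto simp: F_def)
    then show "int (card (F a)) = (2 * int h + 1 - int w) + int a" by simp
  qed simp
  moreover have "(\<Sum>i<2 * h - w. int (card (F (i + (w + 1))))) = (\<Sum>i<2 * h - w. 2 * int h - int i)"
  proof (rule sum.cong)
    fix i assume "i \<in> {..<2 * h - w}"
    then have "F (i + (w + 1)) = {..<2 * h - i}" "i \<le> 2 * h" using s by (auto simp: F_def)
    then show "int (card (F (i + (w + 1)))) = 2 * int h - int i" by simp
  qed simp
  ultimately have "2 * int (card (box_deg (2 * h + 1) s)) =
      int (w + 1) * (2 * (2 * int h + 1 - int w) + int (w + 1) - 1) +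
      int (2 * h - w) * (2 * (2 * int h) - int (2 * h - w) + 1)"
    using double_sum_lessThan_plus[of "2 * int h + 1 - int w" "w + 1"]
      double_sum_lessThan_minus[of "2 * int h" "2 * h - w"] card by linarith
  then show ?thesis
    using s by (simp add: power2_eq_square algebra_simps of_nat_diff)
qed

definition box_lt :: "nat \<Rightarrow> nat \<Rightarrow> (3 \<Rightarrow>\<^sub>0 nat) set"
  where "box_lt q n = {M \<in> box q. total_degree M < n}"

lemma finite_box_lt [simp]: "finite (box_lt q n)"
  by (simp add: box_lt_def)

lemma card_box_lt_Suc: "card (box_lt q (Suc n)) = card (box_lt q n) + card (box_deg q n)"
proof -
  have "box_lt q (Suc n) = box_lt q n \<union> box_deg q n"
    by (auto simp: box_lt_def box_deg_def)
  then show ?thesis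
    by (simp add: card_Un_disjoint box_lt_def box_deg_def disjoint_iff)
qed

text \<open>The induction step adds the layers of degree \<open>3 * h + m\<close> and
  \<open>3 * h - Suc m\<close>. The offsets from \<open>3 * h\<close> run from \<open>-m\<close> to
  \<open>m - 1\<close>, and three times the sum of their squares is \<open>2 * m^3 + m\<close>; the
  factor 3 keeps everything integral.\<close>

lemma card_box_lt_diff:
  assumes "m \<le> h"
  shows "3 * (int (card (box_lt (2 * h + 1) (3 * h + m))) - int (card (box_lt (2 * h + 1) (3 * h - m)))) =
    6 * int m * (3 * (int h)\<^sup>2 + 3 * int h + 1) - (2 * int m ^ 3 + int m)"
  using assms
proof (induction m)
  case (Suc m)
  have "3 * h - m = Suc (3 * h - Suc m)" using Suc.prems by simp
  then have low: "card (box_lt (2 * h + 1) (3 * h - m)) =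
      card (box_lt (2 * h + 1) (3 * h - Suc m)) + card (box_deg (2 * h + 1) (3 * h - Suc m))"
    by (simp only: card_box_lt_Suc)
  have "int (3 * h - Suc m) - 3 * int h = - 1 - int m" using Suc.prems by (simp add: of_nat_diff)
  then have low': "int (card (box_deg (2 * h + 1) (3 * h - Suc m))) =
      3 * (int h)\<^sup>2 + 3 * int h + 1 - (- 1 - int m)\<^sup>2"
    using card_box_deg[of h "3 * h - Suc m"] Suc.prems by simp
  have high: "card (box_lt (2 * h + 1) (3 * h + Suc m)) =
      card (box_lt (2 * h + 1) (3 * h + m)) + card (box_deg (2 * h + 1) (3 * h + m))"
    by (simp only: add_Suc_right card_box_lt_Suc)
  have high': "int (card (box_deg (2 * h + 1) (3 * h + m))) =
      3 * (int h)\<^sup>2 + 3 * int h + 1 - (int m)\<^sup>2"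
    using card_box_deg[of h "3 * h + m"] Suc.prems by simp
  have "3 * (int (card (box_lt (2 * h + 1) (3 * h + Suc m))) -
        int (card (box_lt (2 * h + 1) (3 * h - Suc m)))) =
      3 * (int (card (box_lt (2 * h + 1) (3 * h + m))) - int (card (box_lt (2 * h + 1) (3 * h - m)))) +
      3 * (int (card (box_deg (2 * h + 1) (3 * h + m))) +
           int (card (box_deg (2 * h + 1) (3 * h - Suc m))))"
    unfolding low high by simp
  also have "3 * (int (card (box_lt (2 * h + 1) (3 * h + m))) -
        int (card (box_lt (2 * h + 1) (3 * h - m)))) =
      6 * int m * (3 * (int h)\<^sup>2 + 3 * int h + 1) - (2 * int m ^ 3 + int m)"
    using Suc by simp
  finally show ?case
    unfolding low' high' by (simp add: power2_eq_square power3_eq_cube algebra_simps)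
qed simp

text \<open>Substitution of \<open>h = (q - 1) / 2\<close>, for which
  \<open>3 * h^2 + 3 * h + 1 = (3 * q^2 + 1) / 4\<close>.\<close>

lemma card_box_lt_diff_real:
  assumes "m \<le> h" "d = 2 * m" "q = 2 * h + 1"
  shows "real (card (box_lt q (3 * h + m)) - card (box_lt q (3 * h - m))) =
    3 / 4 * real d * (real q)\<^sup>2 - 1 / 12 * (real d ^ 3 - real d)"
proof -
  have "card (box_lt q (3 * h - m)) \<le> card (box_lt q (3 * h + m))"
    by (rule card_mono) (auto simp: box_lt_def)
  moreover have "3 * (real (card (box_lt q (3 * h + m))) - real (card (box_lt q (3 * h - m)))) =
      6 * real m * (3 * (real h)\<^sup>2 + 3 * real h + 1) - (2 * real m ^ 3 + real m)"
    using arg_cong[OF card_box_lt_diff[OF assms(1)], of real_of_int] unfolding assms(3) by simp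
  ultimately show ?thesis
    by (simp add: assms(2,3) of_nat_diff power2_eq_square power3_eq_cube algebra_simps)
qed

section \<open>The ideal \<open>(f, x\<^sup>q, y\<^sup>q, z\<^sup>q)\<close>\<close>

text \<open>The monomial ideal (x^q, y^q, z^q), encoded by membership of coefficients rather than by
  generators.\<close>

definition frob_ideal :: "nat \<Rightarrow> 'k::field poly3 set"
  where "frob_ideal q = {b. \<forall>M\<in>box q. Poly_Mapping.lookup b M = 0}"

definition curve_frob_ideal :: "'k::field poly3 \<Rightarrow> nat \<Rightarrow> 'k poly3 set"
  where "curve_frob_ideal f q = {f * a + b | a b. b \<in> frob_ideal q}"

definition restrict_poly :: "(3 \<Rightarrow>\<^sub>0 nat) set \<Rightarrow> 'k::field poly3 \<Rightarrow> 'k poly3"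
  where "restrict_poly Y u = (\<Sum>N\<in>Y. Poly_Mapping.single N (Poly_Mapping.lookup u N))"

lemma lookup_restrict_poly:
  "finite Y \<Longrightarrow> Poly_Mapping.lookup (restrict_poly Y u) N = (if N \<in> Y then Poly_Mapping.lookup u N else 0)"
  by (simp add: restrict_poly_def lookup_sum lookup_single when_def)

lemma keys_restrict_poly: "finite Y \<Longrightarrow> Poly_Mapping.keys (restrict_poly Y u) \<subseteq> Y"
  by (auto simp: in_keys_iff lookup_restrict_poly split: if_splits)

lemma frob_ideal_mult:
  assumes "b \<in> frob_ideal q"
  shows "g * b \<in> frob_ideal q"
  unfolding frob_ideal_def
proof (intro CollectI ballI)
  fix M assume M: "M \<in> box q"
  have "mult_coeff g M N * Poly_Mapping.lookup b N = 0" for N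
  proof (cases "\<exists>L. M = L + N")
    case True
    then have "N \<in> box q" using M by (auto simp: box_iff lookup_add)
    then show ?thesis using assms by (simp add: frob_ideal_def)
  qed (simp add: mult_coeff_def)
  then show "Poly_Mapping.lookup (g * b) M = 0"
    unfolding lookup_mult_keys[OF finite_keys order_refl] by (intro sum.neutral ballI)
qed

lemma frob_ideal_add: "a \<in> frob_ideal q \<Longrightarrow> b \<in> frob_ideal q \<Longrightarrow> a + b \<in> frob_ideal q"
  by (auto simp: frob_ideal_def lookup_add)

lemma zero_in_frob_ideal: "0 \<in> frob_ideal q"
  by (simp add: frob_ideal_def)

lemma curve_frob_ideal_mult:
  assumes "h \<in> curve_frob_ideal f q"
  shows "g * h \<in> curve_frob_ideal f q"
proof -
  obtain a b where "h = f * a + b" "b \<in> frob_ideal q"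
    using assms by (auto simp: curve_frob_ideal_def)
  then have "g * h = f * (g * a) + g * b" "g * b \<in> frob_ideal q"
    by (simp add: algebra_simps) (rule frob_ideal_mult, fact)
  then show ?thesis unfolding curve_frob_ideal_def by blast
qed

lemma curve_frob_ideal_add:
  assumes "g \<in> curve_frob_ideal f q" "h \<in> curve_frob_ideal f q"
  shows "g + h \<in> curve_frob_ideal f q"
proof -
  obtain a b a' b' where "g = f * a + b" "b \<in> frob_ideal q" "h = f * a' + b'" "b' \<in> frob_ideal q"
    using assms by (auto simp: curve_frob_ideal_def)
  then have "g + h = f * (a + a') + (b + b')" "b + b' \<in> frob_ideal q"
    by (auto simp: algebra_simps frob_ideal_add)
  then show ?thesis unfolding curve_frob_ideal_def by blast
qed

lemma frob_ideal_subset: "b \<in> frob_ideal q \<Longrightarrow> b \<in> curve_frob_ideal f q"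
  unfolding curve_frob_ideal_def by (intro CollectI exI[of _ 0] exI[of _ b]) simp

lemma multiple_in_curve_frob_ideal: "f * a \<in> curve_frob_ideal f q"
  unfolding curve_frob_ideal_def by (intro CollectI exI[of _ a] exI[of _ 0]) (simp add: zero_in_frob_ideal)

lemma zero_in_curve_frob_ideal: "0 \<in> curve_frob_ideal f q"
  by (intro frob_ideal_subset zero_in_frob_ideal)

lemma curve_frob_ideal_sum:
  "(\<And>i. i \<in> Y \<Longrightarrow> g i \<in> curve_frob_ideal f q) \<Longrightarrow> sum g Y \<in> curve_frob_ideal f q"
  by (induction Y rule: infinite_finite_induct) (auto simp: zero_in_curve_frob_ideal curve_frob_ideal_add)

lemma lookup_mult_low:
  assumes "f \<in> forms d" "total_degree M < d"
  shows "Poly_Mapping.lookup (f * u) M = 0"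
proof -
  have "mult_coeff f M N = 0" for N
    using mult_coeff_forms[OF assms(1), of M N] assms(2) by auto
  then show ?thesis by (simp add: lookup_mult_keys[OF finite_keys order_refl])
qed

text \<open>All constant terms in the ideal vanish. This makes the quotient nonzero, so that the
  constants embed in it as a field of scalars.\<close>

lemma one_notin_curve_frob_ideal:
  assumes "f \<in> forms d" "d > 0" "q > 0"
  shows "1 \<notin> curve_frob_ideal f q"
proof
  assume "1 \<in> curve_frob_ideal f q"
  then obtain a b where ab: "1 = f * a + b" "b \<in> frob_ideal q"
    by (auto simp: curve_frob_ideal_def)
  have "0 \<in> box q" using assms(3) by (simp add: box_iff)
  then have "Poly_Mapping.lookup (f * a + b) 0 = 0"
    using ab(2) lookup_mult_low[OF assms(1), of 0 a] assms(2)
    by (simp add: lookup_add frob_ideal_def total_degree_eq)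
  then show False using ab(1) by simp
qed

section \<open>Passing from the middle degrees to lower and higher ones\<close>

lemma ex_divisor_of_degree:
  assumes "n \<le> total_degree M"
  obtains L N where "M = L + N" "total_degree N = n"
proof -
  define a where "a = min n (Poly_Mapping.lookup M 0)"
  define b where "b = min (n - a) (Poly_Mapping.lookup M 1)"
  define c where "c = n - a - b"
  have le: "a \<le> Poly_Mapping.lookup M 0" "b \<le> Poly_Mapping.lookup M 1" "c \<le> Poly_Mapping.lookup M 2"
    "a + b + c = n"
    using assms by (auto simp: a_def b_def c_def total_degree_eq)
  have "M = (M - exp3 a b c) + exp3 a b c"
    using le by (intro exp3_eqI) (auto simp: lookup_add lookup_minus)
  then show thesis using that[of _ "exp3 a b c"] le(4) by simp
qed

text \<open>The exponents are raised greedily, one variable after another, each to at most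
  \<open>q - 1\<close>. The bound \<open>3 * (q - 1)\<close> is the socle degree.\<close>

lemma ex_multiple_of_degree:
  assumes "N \<in> box q" "total_degree N \<le> n" "n \<le> 3 * (q - 1)"
  obtains L where "N + L \<in> box_deg q n"
proof -
  define x y z where xyz: "x = Poly_Mapping.lookup N 0" "y = Poly_Mapping.lookup N 1"
    "z = Poly_Mapping.lookup N 2"
  have le: "x < q" "y < q" "z < q" "x + y + z \<le> n"
    using assms by (auto simp: xyz box_iff total_degree_eq)
  define a where "a = min (n - (x + y + z)) (q - 1 - x)"
  define b where "b = min (n - (x + y + z) - a) (q - 1 - y)"
  define c where "c = n - (x + y + z) - a - b"
  have "x + a < q" "y + b < q" "z + c < q" "x + y + z + (a + b + c) = n"
    using le assms(3) unfolding c_def b_def a_def min_def by auto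
  then have "N + exp3 a b c \<in> box_deg q n"
    by (auto simp: xyz box_deg_def total_degree_eq box_iff lookup_add)
  then show thesis by (rule that)
qed

lemma lookup_single_mult:
  "Poly_Mapping.lookup (Poly_Mapping.single L 1 * (u :: 'k::field poly3)) (N + L) = Poly_Mapping.lookup u N"
  by (subst mult.commute) (auto simp: lookup_mult_single)

text \<open>Every nonzero element of \<open>k[x,y,z]/(x\<^sup>q,y\<^sup>q,z\<^sup>q)\<close> of degree below \<open>n\<close> has a nonzero
  multiple of degree \<open>n\<close>; so injectivity in degree \<open>n\<close> implies injectivity below.\<close>

lemma mult_inj_imp_eq_0:
  fixes f u :: "'k::field poly3"
  assumes f: "f \<in> forms d" and inj: "mult_inj f q n (n + d)" and n: "n \<le> 3 * (q - 1)"
    and u: "Poly_Mapping.keys u \<subseteq> box_lt q n" and fu: "f * u \<in> frob_ideal q"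
  shows "u = 0"
proof (rule ccontr)
  assume "u \<noteq> 0"
  then obtain N where N: "N \<in> Poly_Mapping.keys u"
    by (metis keys_eq_empty ex_in_conv)
  then have "N \<in> box q" "total_degree N \<le> n" using u by (auto simp: box_lt_def)
  then obtain L where L: "N + L \<in> box_deg q n" using n by (rule ex_multiple_of_degree)
  \<comment> \<open>\<open>u\<close> need not be homogeneous: only the degree \<open>n\<close> part
    of \<open>u'\<close> enters the sums below, and it contains the monomial
    \<open>N + L\<close>.\<close>
  define u' where "u' = Poly_Mapping.single L 1 * u"
  have "f * u' = Poly_Mapping.single L 1 * (f * u)"
    by (simp add: u'_def mult.left_commute)
  then have "f * u' \<in> frob_ideal q" using frob_ideal_mult[OF fu] by (simp only:)
  then have "\<forall>M\<in>box_deg q (n + d). (\<Sum>N\<in>box_deg q n. mult_coeff f M N * Poly_Mapping.lookup u' N) = 0"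
    using lookup_mult_box_deg[OF f, of _ q n u'] by (auto simp: frob_ideal_def box_deg_def)
  then have "Poly_Mapping.lookup u' (N + L) = 0"
    using inj L unfolding mult_inj_def by blast
  then show False
    using N by (simp add: u'_def lookup_single_mult in_keys_iff)
qed

definition mult_surj :: "'k::field poly3 \<Rightarrow> nat \<Rightarrow> nat \<Rightarrow> nat \<Rightarrow> bool"
  where "mult_surj f q n n' \<longleftrightarrow>
    (\<forall>M\<in>box_deg q n'. \<exists>v. \<forall>M'\<in>box_deg q n'.
      (\<Sum>N\<in>box_deg q n. mult_coeff f M' N * v N) = (if M' = M then 1 else 0))"

text \<open>A monomial of degree at least \<open>n + d\<close> is a multiple of one of degree
  exactly \<open>n + d\<close>, and by surjectivity the latter is a multiple of \<open>f\<close>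
  modulo (x^q, y^q, z^q).\<close>

lemma single_in_curve_frob_ideal:
  fixes f :: "'k::field poly3"
  assumes f: "f \<in> forms d" and surj: "mult_surj f q n (n + d)"
    and M: "M \<in> box q" "n + d \<le> total_degree M"
  shows "Poly_Mapping.single M c \<in> curve_frob_ideal f q"
proof -
  obtain L M' where M': "M = L + M'" "total_degree M' = n + d"
    using M(2) by (rule ex_divisor_of_degree)
  then have M'box: "M' \<in> box_deg q (n + d)" using M(1) by (auto simp: box_deg_def box_iff lookup_add)
  then obtain v where v: "\<forall>M''\<in>box_deg q (n + d).
      (\<Sum>N\<in>box_deg q n. mult_coeff f M'' N * v N) = (if M'' = M' then 1 else 0)"
    using surj unfolding mult_surj_def by blast
  define u where "u = (\<Sum>N\<in>box_deg q n. Poly_Mapping.single N (v N))"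
  have lookup_u: "Poly_Mapping.lookup u N = (if N \<in> box_deg q n then v N else 0)" for N
    by (simp add: u_def lookup_sum lookup_single when_def)
  have "u \<in> forms n"
    by (auto simp: forms_def in_keys_iff lookup_u box_deg_def split: if_splits)
  then have fu: "f * u \<in> forms (n + d)" using forms_mult[OF f, of u n] by (simp add: add.commute)
  have "Poly_Mapping.single M' 1 - f * u \<in> frob_ideal q"
    unfolding frob_ideal_def
  proof (intro CollectI ballI)
    fix Y assume Y: "Y \<in> box q"
    show "Poly_Mapping.lookup (Poly_Mapping.single M' 1 - f * u) Y = 0"
    proof (cases "total_degree Y = n + d")
      case True
      then have Y': "Y \<in> box_deg q (n + d)" using Y by (simp add: box_deg_def)
      have "Poly_Mapping.lookup (f * u) Y = (if Y = M' then 1 else 0)"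
        unfolding lookup_mult_box_deg[OF f Y'] using v Y' by (simp add: lookup_u)
      then show ?thesis by (auto simp: lookup_minus lookup_single when_def)
    next
      case False
      then have "Y \<noteq> M'" "Y \<notin> Poly_Mapping.keys (f * u)" using M'(2) fu by (auto simp: forms_def)
      then show ?thesis by (auto simp: lookup_minus lookup_single when_def in_keys_iff)
    qed
  qed
  then have "f * u + (Poly_Mapping.single M' 1 - f * u) \<in> curve_frob_ideal f q"
    by (intro curve_frob_ideal_add multiple_in_curve_frob_ideal frob_ideal_subset)
  then have "Poly_Mapping.single L c * Poly_Mapping.single M' 1 \<in> curve_frob_ideal f q"
    by (intro curve_frob_ideal_mult) simp
  then show ?thesis by (simp add: mult_single M'(1))
qed

text \<open>So the polynomials supported on \<open>box_lt q (n + d)\<close> represent every residue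
  class.\<close>

lemma diff_restrict_in_curve_frob_ideal:
  fixes f g :: "'k::field poly3"
  assumes "f \<in> forms d" "mult_surj f q n (n + d)"
  shows "g - restrict_poly (box_lt q (n + d)) g \<in> curve_frob_ideal f q"
proof -
  let ?r = "g - restrict_poly (box_lt q (n + d)) g"
  have "Poly_Mapping.single M (Poly_Mapping.lookup ?r M) \<in> curve_frob_ideal f q" for M
  proof (cases "M \<in> box q")
    case True
    show ?thesis
    proof (cases "M \<in> box_lt q (n + d)")
      case True
      then show ?thesis by (simp add: lookup_minus lookup_restrict_poly zero_in_curve_frob_ideal)
    next
      case False
      then show ?thesis
        using True by (intro single_in_curve_frob_ideal[OF assms]) (auto simp: box_lt_def)
    qed
  next
    case False
    then show ?thesis
      by (intro frob_ideal_subset) (auto simp: frob_ideal_def lookup_single when_def)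
  qed
  then have "(\<Sum>M\<in>Poly_Mapping.keys ?r. Poly_Mapping.single M (Poly_Mapping.lookup ?r M)) \<in> curve_frob_ideal f q"
    by (intro curve_frob_ideal_sum)
  then show ?thesis by (simp only: sum_single_lookup)
qed

text \<open>Describes the relations among those representatives. In \<open>f * a + b\<close> the
  terms of \<open>a\<close> of degree at least \<open>n\<close> only affect degrees from
  \<open>n + d\<close> on, and its terms outside the box only monomials outside the box; so
  \<open>a\<close> may be cut down to \<open>box_lt q n\<close>.\<close>

lemma curve_frob_ideal_restrict:
  fixes f :: "'k::field poly3"
  assumes f: "f \<in> forms d"
  shows "{w. Poly_Mapping.keys w \<subseteq> box_lt q (n + d)} \<inter> curve_frob_ideal f q =
    (\<lambda>u. restrict_poly (box q) (f * u)) ` {u. Poly_Mapping.keys u \<subseteq> box_lt q n}" (is "?A = ?B")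
proof (intro equalityI subsetI)
  fix w assume "w \<in> ?A"
  then obtain a b where w: "Poly_Mapping.keys w \<subseteq> box_lt q (n + d)" "w = f * a + b" "b \<in> frob_ideal q"
    by (auto simp: curve_frob_ideal_def)
  define u where "u = restrict_poly (box_lt q n) a"
  have "w = restrict_poly (box q) (f * u)"
  proof (rule poly_mapping_eqI)
    fix Y
    show "Poly_Mapping.lookup w Y = Poly_Mapping.lookup (restrict_poly (box q) (f * u)) Y"
    proof (cases "Y \<in> box q")
      case Y: True
      have wX: "Poly_Mapping.lookup w Y = Poly_Mapping.lookup (f * a) Y"
        using Y w by (simp add: lookup_add frob_ideal_def)
      have "Poly_Mapping.lookup w Y = Poly_Mapping.lookup (f * u) Y"
      proof (cases "total_degree Y < d")
        case True
        then show ?thesis using lookup_mult_low[OF f True] by (simp add: wX)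
      next
        case False
        then obtain k where k: "total_degree Y = k + d" by (metis add.commute le_Suc_ex not_less)
        then have Xk: "Y \<in> box_deg q (k + d)" using Y by (simp add: box_deg_def)
        show ?thesis
        proof (cases "k < n")
          case True
          then have "box_deg q k \<subseteq> box_lt q n" by (auto simp: box_deg_def box_lt_def)
          then show ?thesis
            unfolding wX lookup_mult_box_deg[OF f Xk]
            by (intro sum.cong) (auto simp: u_def lookup_restrict_poly)
        next
          case False
          then have "box_deg q k \<inter> box_lt q n = {}" by (auto simp: box_deg_def box_lt_def)
          then have "Poly_Mapping.lookup (f * u) Y = 0"
            unfolding lookup_mult_box_deg[OF f Xk]
            by (intro sum.neutral) (auto simp: u_def lookup_restrict_poly)
          moreover have "Y \<notin> Poly_Mapping.keys w"
            using w(1) k False by (auto simp: box_lt_def)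
          ultimately show ?thesis by (simp add: in_keys_iff)
        qed
      qed
      then show ?thesis using Y by (simp add: lookup_restrict_poly)
    next
      case False
      then have "Y \<notin> Poly_Mapping.keys w" using w(1) by (auto simp: box_lt_def)
      then show ?thesis using False by (simp add: lookup_restrict_poly in_keys_iff)
    qed
  qed
  moreover have "Poly_Mapping.keys u \<subseteq> box_lt q n"
    by (simp add: u_def keys_restrict_poly)
  ultimately show "w \<in> ?B" by blast
next
  fix w assume "w \<in> ?B"
  then obtain u where u: "Poly_Mapping.keys u \<subseteq> box_lt q n" "w = restrict_poly (box q) (f * u)"
    by blast
  have "w - f * u \<in> frob_ideal q"
    by (simp add: u(2) frob_ideal_def lookup_minus lookup_restrict_poly)
  then have "f * u + (w - f * u) \<in> curve_frob_ideal f q"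
    by (intro curve_frob_ideal_add multiple_in_curve_frob_ideal frob_ideal_subset)
  moreover have "Y \<in> box_lt q (n + d)" if Y: "Y \<in> Poly_Mapping.keys w" for Y
  proof -
    have Y': "Y \<in> box q" "Poly_Mapping.lookup (f * u) Y \<noteq> 0"
      using Y by (auto simp: u(2) in_keys_iff lookup_restrict_poly split: if_splits)
    then obtain N where N: "N \<in> Poly_Mapping.keys u" "mult_coeff f Y N \<noteq> 0"
      unfolding lookup_mult_keys[OF finite_keys order_refl]
      by (auto elim: sum.not_neutral_contains_not_neutral)
    then show ?thesis
      using mult_coeff_forms[OF f N(2)] u(1) Y'(1) by (auto simp: box_lt_def)
  qed
  ultimately show "w \<in> ?A" by auto
qed

lemma inj_on_restrict_mult:
  fixes f :: "'k::field poly3"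
  assumes f: "f \<in> forms d" and inj: "mult_inj f q n (n + d)" and n: "n \<le> 3 * (q - 1)"
  shows "inj_on (\<lambda>u. restrict_poly (box q) (f * u)) {u. Poly_Mapping.keys u \<subseteq> box_lt q n}"
proof (rule inj_onI)
  fix u v :: "'k poly3"
  assume u: "u \<in> {u. Poly_Mapping.keys u \<subseteq> box_lt q n}" and v: "v \<in> {u. Poly_Mapping.keys u \<subseteq> box_lt q n}"
    and eq: "restrict_poly (box q) (f * u) = restrict_poly (box q) (f * v)"
  have "f * (u - v) \<in> frob_ideal q"
    unfolding frob_ideal_def
  proof (intro CollectI ballI)
    fix M assume "M \<in> box q"
    then show "Poly_Mapping.lookup (f * (u - v)) M = 0"
      using arg_cong[OF eq, of "\<lambda>g. Poly_Mapping.lookup g M"]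
      by (simp add: lookup_restrict_poly right_diff_distrib lookup_minus)
  qed
  moreover have "Poly_Mapping.keys (u - v) \<subseteq> box_lt q n"
    using u v by (auto simp: in_keys_iff lookup_minus) (metis in_keys_iff subsetD)
  ultimately have "u - v = 0" by (intro mult_inj_imp_eq_0[OF f inj n])
  then show "u = v" by simp
qed

section \<open>The Hilbert--Kunz function as a dimension\<close>

lemma quot_proj:
  assumes "ideal I R"
  shows "ring_hom_ring R (R Quot I) ((+>\<^bsub>R\<^esub>) I)"
    and "carrier (R Quot I) = (+>\<^bsub>R\<^esub>) I ` carrier R"
    and "x \<in> carrier R \<Longrightarrow> I +>\<^bsub>R\<^esub> x = \<zero>\<^bsub>R Quot I\<^esub> \<longleftrightarrow> x \<in> I"
proof -
  interpret ideal I R by fact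
  show "ring_hom_ring R (R Quot I) ((+>\<^bsub>R\<^esub>) I)" by (rule rcos_ring_hom_ring)
  show "carrier (R Quot I) = (+>\<^bsub>R\<^esub>) I ` carrier R"
    by (auto simp: FactRing_def A_RCOSETS_def')
  show "I +>\<^bsub>R\<^esub> x = \<zero>\<^bsub>R Quot I\<^esub> \<longleftrightarrow> x \<in> I" if "x \<in> carrier R"
    using that a_rcos_zero[OF is_ideal] rcos_const_imp_mem by (auto simp: FactRing_def)
qed

lemma poly3_ring_simps [simp]:
  "carrier (poly3_ring :: 'k::field poly3 ring) = UNIV"
  "x \<otimes>\<^bsub>poly3_ring\<^esub> y = x * (y :: 'k poly3)"
  "x \<oplus>\<^bsub>poly3_ring\<^esub> y = x + (y :: 'k poly3)"
  "\<one>\<^bsub>poly3_ring\<^esub> = (1 :: 'k poly3)"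
  "\<zero>\<^bsub>poly3_ring\<^esub> = (0 :: 'k poly3)"
  by (simp_all add: ring_of_type_algebra_def)

lemma cring_poly3_ring: "cring (poly3_ring :: 'k::field poly3 ring)"
  by (rule cring_from_type_algebra)

lemma ring_poly3_ring: "ring (poly3_ring :: 'k::field poly3 ring)"
  by (rule ring_from_type_algebra)

lemma ideal_poly3_ringI:
  fixes J :: "'k::field poly3 set"
  assumes "0 \<in> J" "\<And>a b. a \<in> J \<Longrightarrow> b \<in> J \<Longrightarrow> a + b \<in> J" "\<And>a c. a \<in> J \<Longrightarrow> c * a \<in> J"
  shows "ideal J poly3_ring"
proof -
  interpret cring "poly3_ring :: 'k poly3 ring" by (rule cring_poly3_ring)
  have uminus: "\<ominus>\<^bsub>poly3_ring\<^esub> x = - (x :: 'k poly3)" for x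
    by (rule minus_equality) auto
  show ?thesis
  proof (rule idealI)
    show "subgroup J (add_monoid poly3_ring)"
    proof (rule subgroup.intro)
      fix x assume "x \<in> J"
      then have "(-1) * x \<in> J" by (rule assms(3))
      then show "inv\<^bsub>add_monoid poly3_ring\<^esub> x \<in> J"
        using uminus[of x] by (simp add: a_inv_def)
    qed (use assms in auto)
  qed (use assms in \<open>auto simp: ring_poly3_ring mult.commute\<close>)
qed

lemma ideal_curve_frob_ideal: "ideal (curve_frob_ideal f q) poly3_ring"
  by (intro ideal_poly3_ringI zero_in_curve_frob_ideal curve_frob_ideal_add curve_frob_ideal_mult)

lemma ideal_poly3_ringD:
  fixes J :: "'k::field poly3 set"
  assumes "ideal J poly3_ring"
  shows "0 \<in> J" "a \<in> J \<Longrightarrow> b \<in> J \<Longrightarrow> a + b \<in> J" "a \<in> J \<Longrightarrow> c * a \<in> J"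
proof -
  note add = ideal.axioms(1)[OF assms]
  show "0 \<in> J" using additive_subgroup.zero_closed[OF add] by simp
  show "a + b \<in> J" if "a \<in> J" "b \<in> J" using additive_subgroup.a_closed[OF add that] by simp
  show "c * a \<in> J" if "a \<in> J" using ideal.I_l_closed[OF assms that, of c] by simp
qed

lemma ideal_curve: "ideal (Idl\<^bsub>poly3_ring\<^esub> {f}) (poly3_ring :: 'k::field poly3 ring)"
  by (rule ring.genideal_ideal[OF ring_poly3_ring]) simp

lemma Var_power: "Var i ^ n = Poly_Mapping.single (Poly_Mapping.single i n) (1 :: 'k::field)"
  by (induction n) (auto simp: Var_def mult_single single_add[symmetric])

lemma Var_power_in_frob_ideal: "(Var i ^ q :: 'k::field poly3) \<in> frob_ideal q"
  by (auto simp: frob_ideal_def Var_power lookup_single when_def box_def)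

text \<open>A monomial outside the box is a multiple of some \<open>Var i ^ q\<close>. With
  \<open>Var_power_in_frob_ideal\<close> this identifies \<open>frob_ideal q\<close> as the ideal
  generated by these powers.\<close>

lemma frob_ideal_minimal:
  fixes J :: "'k::field poly3 set"
  assumes J: "ideal J poly3_ring" and vars: "\<And>i. Var i ^ q \<in> J" and b: "b \<in> frob_ideal q"
  shows "b \<in> J"
proof -
  have sum: "(\<And>i. i \<in> Y \<Longrightarrow> g i \<in> J) \<Longrightarrow> sum g Y \<in> J" for g :: "(3 \<Rightarrow>\<^sub>0 nat) \<Rightarrow> _" and Y
    by (induction Y rule: infinite_finite_induct) (auto simp: ideal_poly3_ringD[OF J])
  have "Poly_Mapping.single M (Poly_Mapping.lookup b M) \<in> J" if "M \<in> Poly_Mapping.keys b" for M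
  proof -
    have "M \<notin> box q" using b that by (auto simp: frob_ideal_def in_keys_iff)
    then obtain i where i: "q \<le> Poly_Mapping.lookup M i" by (auto simp: box_def not_less)
    have "M = (M - Poly_Mapping.single i q) + Poly_Mapping.single i q"
      using i by (intro poly_mapping_eqI) (auto simp: lookup_add lookup_minus lookup_single when_def)
    then have "Poly_Mapping.single M (Poly_Mapping.lookup b M) =
        Poly_Mapping.single (M - Poly_Mapping.single i q) (Poly_Mapping.lookup b M) * Var i ^ q"
      by (simp add: Var_power mult_single)
    then show ?thesis using ideal_poly3_ringD(3)[OF J vars[of i]] by simp
  qed
  then have "(\<Sum>M\<in>Poly_Mapping.keys b. Poly_Mapping.single M (Poly_Mapping.lookup b M)) \<in> J"
    by (rule sum)
  then show ?thesis by (simp only: sum_single_lookup)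
qed

definition bracket_proj :: "'k::field poly3 \<Rightarrow> nat \<Rightarrow> 'k poly3 \<Rightarrow> 'k poly3 set set"
  where "bracket_proj f q g = bracket_power f q +>\<^bsub>curve_ring f\<^esub> curve_proj f g"

text \<open>Replaces the two successive quotients by one surjection from the polynomial ring, with
  kernel (f, x^q, y^q, z^q), so that dimensions can be counted with polynomials.\<close>

lemma
  fixes f :: "'k::field poly3"
  shows bracket_proj_hom: "ring_hom_ring poly3_ring (bracket_quotient f q) (bracket_proj f q)"
    and bracket_proj_surj: "carrier (bracket_quotient f q) = range (bracket_proj f q)"
    and bracket_proj_eq_zero_iff:
      "bracket_proj f q g = \<zero>\<^bsub>bracket_quotient f q\<^esub> \<longleftrightarrow> g \<in> curve_frob_ideal f q"
proof -
  let ?I = "Idl\<^bsub>poly3_ring\<^esub> {f}" and ?C = "curve_ring f" and ?J = "curve_frob_ideal f q"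
  let ?gens = "{curve_proj f (Var i) [^]\<^bsub>curve_ring f\<^esub> q |i. i \<in> UNIV}"
  note proj = quot_proj[OF ideal_curve[of f], folded curve_ring_def curve_proj_def]
  interpret \<pi>: ring_hom_ring poly3_ring ?C "curve_proj f"
    using proj(1) unfolding curve_proj_def .
  have pow: "curve_proj f x [^]\<^bsub>?C\<^esub> n = curve_proj f (x ^ n)" for x and n :: nat
    using \<pi>.hom_one \<pi>.hom_mult[of "x ^ _" x]
    by (induction n) (simp_all add: power_Suc2 del: power_Suc)
  have gens: "?gens \<subseteq> carrier ?C"
    using \<pi>.hom_closed by (auto simp: pow)
  have B: "ideal (bracket_power f q) ?C"
    unfolding bracket_power_def by (rule \<pi>.S.genideal_ideal[OF gens])
  note proj' = quot_proj[OF B, folded bracket_quotient_def]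
  interpret \<rho>: ring_hom_ring ?C "bracket_quotient f q" "(+>\<^bsub>?C\<^esub>) (bracket_power f q)"
    by (rule proj'(1))
  have comp: "bracket_proj f q = (+>\<^bsub>?C\<^esub>) (bracket_power f q) \<circ> curve_proj f"
    by (auto simp: bracket_proj_def)
  show "ring_hom_ring poly3_ring (bracket_quotient f q) (bracket_proj f q)"
    unfolding comp
    by (intro ring_hom_ringI2 \<pi>.R.ring_axioms \<rho>.S.ring_axioms ring_hom_trans[OF \<pi>.homh \<rho>.homh])
  have carrier: "carrier ?C = range (curve_proj f)"
    using proj(2) by (simp add: curve_proj_def[abs_def])
  show "carrier (bracket_quotient f q) = range (bracket_proj f q)"
    unfolding proj'(2) carrier comp by (simp add: image_comp)
  have zero: "curve_proj f g = \<zero>\<^bsub>?C\<^esub> \<longleftrightarrow> g \<in> ?I" for g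
    using proj(3)[of g] by simp
  have f_I: "f \<in> ?I" by (rule \<pi>.R.genideal_self') simp
  have I_J: "?I \<subseteq> ?J"
    using multiple_in_curve_frob_ideal[of f 1 q]
    by (intro \<pi>.R.genideal_minimal ideal_curve_frob_ideal) auto
  have "curve_proj f g \<in> bracket_power f q \<longleftrightarrow> g \<in> ?J"
  proof
    assume g: "g \<in> ?J"
    \<comment> \<open>The preimage of the bracket power is an ideal containing \<open>f\<close> and
      all \<open>Var i ^ q\<close>, hence all of \<open>?J\<close>.\<close>
    have "ideal {r \<in> carrier poly3_ring. curve_proj f r \<in> bracket_power f q} poly3_ring"
      by (rule \<pi>.ideal_vimage[OF B])
    then have pull: "ideal {r. curve_proj f r \<in> bracket_power f q} poly3_ring" by simp
    have f: "f \<in> {r. curve_proj f r \<in> bracket_power f q}"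
      using zero[of f] f_I additive_subgroup.zero_closed[OF ideal.axioms(1)[OF B]] by simp
    have "?gens \<subseteq> bracket_power f q"
      unfolding bracket_power_def by (rule \<pi>.S.genideal_self[OF gens])
    then have vars: "Var i ^ q \<in> {r. curve_proj f r \<in> bracket_power f q}" for i
      by (auto simp: pow)
    obtain a b where "g = f * a + b" "b \<in> frob_ideal q"
      using g by (auto simp: curve_frob_ideal_def)
    then have "g \<in> {r. curve_proj f r \<in> bracket_power f q}"
      using frob_ideal_minimal[OF pull vars] ideal_poly3_ringD(2,3)[OF pull] f
      by (metis mult.commute)
    then show "curve_proj f g \<in> bracket_power f q" by simp
  next
    assume "curve_proj f g \<in> bracket_power f q"
    \<comment> \<open>Conversely, the image of \<open>?J\<close> is an ideal containing the
      generators, hence the bracket power. A preimage \<open>g\<close> then differs from an element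
      of \<open>?J\<close> by a multiple of \<open>f\<close>, which lies in \<open>?J\<close>
      too.\<close>
    have "ideal (curve_proj f ` ?J) ?C"
      using \<pi>.R.ring_ideal_imp_quot_ideal[OF ideal_curve ideal_curve_frob_ideal]
      by (simp add: curve_ring_def curve_proj_def[abs_def])
    moreover have "?gens \<subseteq> curve_proj f ` ?J"
      using frob_ideal_subset[OF Var_power_in_frob_ideal, of _ q f] by (auto simp: pow)
    ultimately have "bracket_power f q \<subseteq> curve_proj f ` ?J"
      unfolding bracket_power_def by (rule \<pi>.S.genideal_minimal)
    then obtain j where j: "j \<in> ?J" "curve_proj f g = curve_proj f j"
      using \<open>curve_proj f g \<in> bracket_power f q\<close> by auto
    have "curve_proj f ((g - j) + j) = curve_proj f (g - j) \<oplus>\<^bsub>?C\<^esub> curve_proj f j"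
      using \<pi>.hom_add[of "g - j" j] by simp
    then have "curve_proj f j = curve_proj f (g - j) \<oplus>\<^bsub>?C\<^esub> curve_proj f j"
      using j(2) by simp
    then have "curve_proj f (g - j) = \<zero>\<^bsub>?C\<^esub>"
      using \<pi>.hom_closed[of "g - j"] \<pi>.hom_closed[of j] by simp
    then have "g - j \<in> ?J" using zero I_J by blast
    then have "(g - j) + j \<in> ?J" using j(1) by (rule curve_frob_ideal_add)
    then show "g \<in> ?J" by simp
  qed
  then show "bracket_proj f q g = \<zero>\<^bsub>bracket_quotient f q\<^esub> \<longleftrightarrow> g \<in> ?J"
    using proj'(3)[of "curve_proj f g"] \<pi>.hom_closed[of g] by (simp add: bracket_proj_def)
qed

section \<open>Dimensions over the field of constants\<close>

lemma subfield_Const: "subfield (range Const) (poly3_ring :: 'k::field poly3 ring)"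
proof -
  interpret F: Ring.field "ring_of_type_algebra :: 'k ring" by (rule field_from_type_algebra)
  interpret h: ring_hom_ring "ring_of_type_algebra :: 'k ring" "poly3_ring :: 'k poly3 ring" Const
    by (intro ring_hom_ringI F.ring_axioms ring_poly3_ring)
      (simp_all add: ring_of_type_algebra_def Const_def mult_single single_add)
  show ?thesis
    using h.img_is_subfield(2)[OF F.carrier_is_subfield] by (simp add: ring_of_type_algebra_def)
qed

lemma dimension_keys_subset:
  assumes "finite Y"
  shows "ring.dimension poly3_ring (card Y) (range Const)
    {w :: 'k::field poly3. Poly_Mapping.keys w \<subseteq> Y}"
  using assms
proof (induction Y rule: finite_induct)
  case empty
  interpret ring "poly3_ring :: 'k poly3 ring" by (rule ring_poly3_ring)
  have "{w :: 'k poly3. Poly_Mapping.keys w \<subseteq> {}} = {\<zero>\<^bsub>poly3_ring\<^esub>}"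
    by (auto intro: poly_mapping_eqI simp: in_keys_iff)
  then show ?case by (simp only: card.empty zero_dim)
next
  case (insert M Y)
  interpret ring "poly3_ring :: 'k poly3 ring" by (rule ring_poly3_ring)
  let ?E = "{w :: 'k poly3. Poly_Mapping.keys w \<subseteq> Y}" and ?v = "Poly_Mapping.single M (1 :: 'k)"
  have "dimension (Suc (card Y)) (range Const) (line_extension (range Const) ?v ?E)"
    using insert by (intro Suc_dim) auto
  moreover have "line_extension (range Const) ?v ?E = {w. Poly_Mapping.keys w \<subseteq> insert M Y}"
  proof (intro equalityI subsetI)
    fix w assume "w \<in> line_extension (range Const) ?v ?E"
    then obtain c e where "w = Const c * ?v + e" "Poly_Mapping.keys e \<subseteq> Y"
      by (auto simp: line_extension_mem_iff)
    then show "w \<in> {w. Poly_Mapping.keys w \<subseteq> insert M Y}"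
      by (auto simp: in_keys_iff Const_def mult_single lookup_add lookup_single when_def split: if_splits)
  next
    fix w :: "'k poly3" assume w: "w \<in> {w. Poly_Mapping.keys w \<subseteq> insert M Y}"
    let ?c = "Poly_Mapping.lookup w M"
    have "w = Const ?c * ?v + (w - Poly_Mapping.single M ?c)"
      by (simp add: Const_def mult_single)
    moreover have "w - Poly_Mapping.single M ?c \<in> ?E"
      using w by (auto simp: in_keys_iff lookup_minus lookup_single when_def split: if_splits)
    ultimately show "w \<in> line_extension (range Const) ?v ?E"
      unfolding line_extension_mem_iff by fastforce
  qed
  ultimately show ?case using insert.hyps by simp
qed

text \<open>Induction along the \<open>dimension\<close> predicate: \<open>T\<close> carries line
  extensions to line extensions. It is only assumed linear because it will be multiplication by
  \<open>f\<close> followed by truncation to the box, which is not multiplicative.\<close>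

lemma dimension_linear_image:
  fixes T :: "'k::field poly3 \<Rightarrow> 'k poly3"
  assumes add: "\<And>u v. T (u + v) = T u + T v" and smult: "\<And>k u. k \<in> K \<Longrightarrow> T (k * u) = k * T u"
    and K: "subfield K poly3_ring" and dim: "ring.dimension poly3_ring n K E" and inj: "inj_on T E"
  shows "ring.dimension poly3_ring n K (T ` E)"
proof -
  interpret ring "poly3_ring :: 'k poly3 ring" by (rule ring_poly3_ring)
  have "T 0 + 0 = T 0 + T 0" using add[of 0 0] by simp
  then have T0: "T 0 = 0" by (metis add_left_imp_eq)
  show ?thesis
    using dim inj smult K
  proof (induction rule: dimension.induct)
    case (zero_dim K)
    then show ?case using dimension.zero_dim[of K] T0 by simp
  next
    case (Suc_dim v E n K)
    have K01: "0 \<in> K" "1 \<in> K"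
      using subringE(2,3)[OF subfieldE(1)[OF Suc_dim.prems(3)]] by auto
    have E0: "0 \<in> E"
      using space_subgroup_props(2)[OF Suc_dim.prems(3) Suc_dim.hyps(3)] by simp
    have E_sub: "E \<subseteq> line_extension K v E"
      using K01(1) by (force simp: line_extension_mem_iff)
    have v_mem: "v \<in> line_extension K v E"
      using K01(2) E0 by (force simp: line_extension_mem_iff)
    have img: "T ` line_extension K v E = line_extension K (T v) (T ` E)"
    proof (intro equalityI subsetI)
      fix w assume "w \<in> T ` line_extension K v E"
      then obtain k e where "k \<in> K" "e \<in> E" "w = T (k * v + e)"
        by (auto simp: line_extension_mem_iff)
      then show "w \<in> line_extension K (T v) (T ` E)"
        unfolding line_extension_mem_iff using add Suc_dim.prems(2) by auto
    next
      fix w assume "w \<in> line_extension K (T v) (T ` E)"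
      then obtain k e where ke: "k \<in> K" "e \<in> E" "w = k * T v + T e"
        by (auto simp: line_extension_mem_iff)
      then have "w = T (k * v + e)" using add Suc_dim.prems(2) by auto
      moreover have "k * v + e \<in> line_extension K v E"
        unfolding line_extension_mem_iff using ke by auto
      ultimately show "w \<in> T ` line_extension K v E" by blast
    qed
    have "T v \<notin> T ` E"
      using Suc_dim.prems(1) Suc_dim.hyps(2) E_sub v_mem by (auto simp: inj_on_def)
    moreover have "dimension n K (T ` E)"
      using Suc_dim.IH inj_on_subset[OF Suc_dim.prems(1) E_sub] Suc_dim.prems(2,3) by blast
    ultimately show ?case
      unfolding img by (intro dimension.Suc_dim) auto
  qed
qed

text \<open>Rank-nullity for the projection restricted to \<open>?W\<close>. Surjectivity of
  multiplication makes it onto; its kernel is the image of the polynomials on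
  \<open>box_lt q n\<close> under truncated multiplication by \<open>f\<close>, which is injective
  there.\<close>

lemma HK_eq:
  fixes f :: "'k::field poly3"
  assumes f: "f \<in> forms d" and d: "d > 0" and q: "q > 0" and n: "n \<le> 3 * (q - 1)"
    and inj: "mult_inj f q n (n + d)" and surj: "mult_surj f q n (n + d)"
  shows "HK f q = card (box_lt q (n + d)) - card (box_lt q n)"
proof -
  let ?K = "range Const :: 'k poly3 set"
  let ?W = "{w :: 'k poly3. Poly_Mapping.keys w \<subseteq> box_lt q (n + d)}"
  let ?T = "\<lambda>u. restrict_poly (box q) (f * u)"
  interpret ring_hom_ring poly3_ring "bracket_quotient f q" "bracket_proj f q"
    by (rule bracket_proj_hom)
  have one_zero: "\<one>\<^bsub>bracket_quotient f q\<^esub> \<noteq> \<zero>\<^bsub>bracket_quotient f q\<^esub>"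
    using bracket_proj_eq_zero_iff[of f q 1] one_notin_curve_frob_ideal[OF f d q] hom_one by auto
  have scalars: "bracket_scalars f q = bracket_proj f q ` ?K"
    by (auto simp: bracket_scalars_def bracket_proj_def)
  have "a_kernel (poly3_ring\<lparr>carrier := ?W\<rparr>) (bracket_quotient f q) (bracket_proj f q) =
      ?W \<inter> curve_frob_ideal f q"
    unfolding a_kernel_def' bracket_proj_eq_zero_iff by (simp add: Int_def)
  also have "\<dots> = ?T ` {u. Poly_Mapping.keys u \<subseteq> box_lt q n}"
    by (rule curve_frob_ideal_restrict[OF f])
  also have "R.dimension (card (box_lt q n)) ?K \<dots>"
  proof (rule dimension_linear_image[OF _ _ subfield_Const dimension_keys_subset])
    show "inj_on ?T {u. Poly_Mapping.keys u \<subseteq> box_lt q n}"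
      by (rule inj_on_restrict_mult[OF f inj n])
    show "?T (u + v) = ?T u + ?T v" for u v
      by (intro poly_mapping_eqI) (simp add: lookup_restrict_poly lookup_add distrib_left)
    show "?T (k * u) = k * ?T u" if k: "k \<in> ?K" for k u
    proof (rule poly_mapping_eqI)
      fix M
      obtain c where c: "k = Poly_Mapping.single 0 c" using k by (auto simp: Const_def)
      have lookup: "Poly_Mapping.lookup (k * g) M = c * Poly_Mapping.lookup g M" for g :: "'k poly3"
        unfolding c by (subst mult.commute) (simp add: lookup_mult_single mult.commute)
      have "f * (k * u) = k * (f * u)" by (rule mult.left_commute)
      then have "Poly_Mapping.lookup (f * (k * u)) M = c * Poly_Mapping.lookup (f * u) M"
        by (simp only: lookup)
      then show "Poly_Mapping.lookup (?T (k * u)) M = Poly_Mapping.lookup (k * ?T u) M"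
        by (simp add: lookup lookup_restrict_poly)
    qed
  qed simp
  finally have ker: "R.dimension (card (box_lt q n)) ?K
      (a_kernel (poly3_ring\<lparr>carrier := ?W\<rparr>) (bracket_quotient f q) (bracket_proj f q))" .
  have "bracket_proj f q ` ?W = carrier (bracket_quotient f q)"
  proof -
    have "bracket_proj f q g \<in> bracket_proj f q ` ?W" for g
    proof -
      let ?w = "restrict_poly (box_lt q (n + d)) g"
      have "bracket_proj f q (g - ?w) = \<zero>\<^bsub>bracket_quotient f q\<^esub>"
        using diff_restrict_in_curve_frob_ideal[OF f surj] by (simp add: bracket_proj_eq_zero_iff)
      moreover have "bracket_proj f q ((g - ?w) + ?w) =
          bracket_proj f q (g - ?w) \<oplus>\<^bsub>bracket_quotient f q\<^esub> bracket_proj f q ?w"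
        using hom_add[of "g - ?w" ?w] by simp
      ultimately have "bracket_proj f q g = bracket_proj f q ?w"
        using hom_closed[of ?w] by simp
      moreover have "?w \<in> ?W" by (simp add: keys_restrict_poly)
      ultimately show ?thesis by blast
    qed
    then show ?thesis unfolding bracket_proj_surj by auto
  qed
  then have "S.dimension (card (box_lt q (n + d)) - card (box_lt q n)) (bracket_scalars f q)
      (carrier (bracket_quotient f q))"
    using rank_nullity_theorem[OF subfield_Const one_zero dimension_keys_subset ker] scalars by simp
  then have "(S.dim over bracket_scalars f q) (carrier (bracket_quotient f q)) =
      card (box_lt q (n + d)) - card (box_lt q n)"
    unfolding scalars by (rule S.dimI[OF img_is_subfield(2)[OF subfield_Const one_zero]])
  then show ?thesis by (simp add: HK_def over_def)
qed

section \<open>Openness\<close>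

text \<open>Equal cardinalities make the multiplication matrix square, so one determinant decides
  injectivity, and injectivity gives surjectivity.\<close>

lemma mult_inj_iff_det:
  fixes q n n' :: nat
  assumes card: "card (box_deg q n') = card (box_deg q n)"
  obtains g :: "(3 \<Rightarrow>\<^sub>0 nat, 'k::field) mpoly"
  where "\<And>f :: 'k poly3. eval_mpoly (Poly_Mapping.lookup f) g \<noteq> 0 \<longleftrightarrow> mult_inj f q n n'"
    and "\<And>f :: 'k poly3. mult_inj f q n n' \<Longrightarrow> mult_surj f q n n'"
proof -
  define r where "r = card (box_deg q n)"
  obtain lo where lo: "bij_betw lo {0..<r} (box_deg q n)"
    using ex_bij_betw_nat_finite[OF finite_box_deg] unfolding r_def by blast
  obtain hi where hi: "bij_betw hi {0..<r} (box_deg q n')"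
    using ex_bij_betw_nat_finite[OF finite_box_deg] card unfolding r_def by metis
  have lo_ex: "\<exists>j<r. N = lo j" if "N \<in> box_deg q n" for N
    using that lo by (force simp: bij_betw_def image_iff)
  have hi_ex: "\<exists>i<r. M = hi i" if "M \<in> box_deg q n'" for M
    using that hi by (force simp: bij_betw_def image_iff)
  \<comment> \<open>The generic multiplication matrix: its variables are indexed by exponent vectors
    and stand for the coefficients of a form, so evaluation at \<open>f\<close> yields
    \<open>A f\<close>.\<close>
  define G :: "(3 \<Rightarrow>\<^sub>0 nat, 'k) mpoly mat" where
    "G = mat r r (\<lambda>(i, j). if \<exists>L. hi i = L + lo j then Var (hi i - lo j) else 0)"
  define A :: "'k poly3 \<Rightarrow> 'k mat" where
    "A f = mat r r (\<lambda>(i, j). mult_coeff f (hi i) (lo j))" for f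
  have A: "A f \<in> carrier_mat r r" for f by (simp add: A_def)
  have map_G: "map_mat (eval_mpoly (Poly_Mapping.lookup f)) G = A f" for f :: "'k poly3"
    by (intro eq_matI) (auto simp: G_def A_def mult_coeff_def eval_mpoly_Var eval_mpoly_0)
  have eval_det: "eval_mpoly (Poly_Mapping.lookup f) (det G) = det (A f)" for f
    by (simp flip: map_G)
  define idx where "idx = inv_into {0..<r} lo"
  have idx: "idx (lo j) = j" if "j < r" for j
    using that lo by (simp add: idx_def bij_betw_def)
  have sum_lo: "(\<Sum>N\<in>box_deg q n. F N) = (\<Sum>j=0..<r. F (lo j))" for F :: "_ \<Rightarrow> 'k"
    by (rule sum.reindex_bij_betw[OF lo, symmetric])
  have det_iff: "det (A f) \<noteq> 0 \<longleftrightarrow> mult_inj f q n n'" for f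
  proof
    assume det: "det (A f) \<noteq> 0"
    show "mult_inj f q n n'"
      unfolding mult_inj_def
    proof (intro allI impI)
      fix v assume v: "\<forall>M\<in>box_deg q n'. (\<Sum>N\<in>box_deg q n. mult_coeff f M N * v N) = 0"
      have "A f *\<^sub>v vec r (\<lambda>j. v (lo j)) = 0\<^sub>v r"
      proof (rule eq_vecI)
        fix i assume i: "i < dim_vec (0\<^sub>v r :: 'k vec)"
        then have "hi i \<in> box_deg q n'" using hi by (auto simp: bij_betw_def)
        then show "vec_index (A f *\<^sub>v vec r (\<lambda>j. v (lo j))) i = vec_index (0\<^sub>v r) i"
          using v i by (simp add: A_def scalar_prod_def sum_lo)
      qed (simp add: A_def)
      then have zero: "vec r (\<lambda>j. v (lo j)) = 0\<^sub>v r"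
        using det det_0_iff_vec_prod_zero_field[OF A, of f] vec_carrier by blast
      show "\<forall>N\<in>box_deg q n. v N = 0"
      proof
        fix N assume "N \<in> box_deg q n"
        then obtain j where "j < r" "N = lo j" using lo_ex by blast
        then show "v N = 0" using arg_cong[OF zero, of "\<lambda>w. vec_index w j"] by simp
      qed
    qed
  next
    assume inj: "mult_inj f q n n'"
    show "det (A f) \<noteq> 0"
    proof
      assume "det (A f) = 0"
      then obtain v where v: "v \<in> carrier_vec r" "v \<noteq> 0\<^sub>v r" "A f *\<^sub>v v = 0\<^sub>v r"
        using det_0_iff_vec_prod_zero_field[OF A] by blast
      have "\<forall>M\<in>box_deg q n'. (\<Sum>N\<in>box_deg q n. mult_coeff f M N * vec_index v (idx N)) = 0"
      proof
        fix M assume "M \<in> box_deg q n'"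
        then obtain i where i: "i < r" "M = hi i" using hi_ex by blast
        then show "(\<Sum>N\<in>box_deg q n. mult_coeff f M N * vec_index v (idx N)) = 0"
          using arg_cong[OF v(3), of "\<lambda>w. vec_index w i"] v(1)
          by (simp add: A_def scalar_prod_def sum_lo idx)
      qed
      then have zero: "\<forall>N\<in>box_deg q n. vec_index v (idx N) = 0"
        using inj unfolding mult_inj_def by (elim allE[of _ "\<lambda>N. vec_index v (idx N)"] impE) auto
      have "v = 0\<^sub>v r"
      proof (rule eq_vecI)
        fix j assume j: "j < dim_vec (0\<^sub>v r :: 'k vec)"
        then have "lo j \<in> box_deg q n" using lo by (auto simp: bij_betw_def)
        then show "vec_index v j = vec_index (0\<^sub>v r) j" using zero j idx by fastforce
      qed (use v in simp)
      then show False using v(2) by blast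
    qed
  qed
  show thesis
  proof (rule that[of "det G"])
    show "eval_mpoly (Poly_Mapping.lookup f) (det G) \<noteq> 0 \<longleftrightarrow> mult_inj f q n n'" for f :: "'k poly3"
      by (simp add: eval_det det_iff)
  next
    fix f :: "'k poly3" assume "mult_inj f q n n'"
    then have "det (A f) \<noteq> 0" by (simp add: det_iff)
    then obtain B where B: "B \<in> carrier_mat r r" "A f * B = 1\<^sub>m r"
      using det_non_zero_imp_unit[OF A, of f "()"] by (auto simp: Units_def ring_mat_def)
    show "mult_surj f q n n'"
      unfolding mult_surj_def
    proof
      fix M assume "M \<in> box_deg q n'"
      then obtain k where k: "k < r" "M = hi k" using hi_ex by blast
      show "\<exists>v. \<forall>M'\<in>box_deg q n'.
          (\<Sum>N\<in>box_deg q n. mult_coeff f M' N * v N) = (if M' = M then 1 else 0)"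
      \<comment> \<open>Column \<open>k\<close> of the inverse matrix is the preimage of the
        monomial \<open>hi k\<close>.\<close>
      proof (intro exI[of _ "\<lambda>N. B $$ (idx N, k)"] ballI)
        fix M' assume "M' \<in> box_deg q n'"
        then obtain i where i: "i < r" "M' = hi i" using hi_ex by blast
        have "M' = M \<longleftrightarrow> i = k"
          using i k hi by (auto simp: bij_betw_def inj_on_def)
        moreover have "(\<Sum>N\<in>box_deg q n. mult_coeff f M' N * B $$ (idx N, k)) = (A f * B) $$ (i, k)"
          using i k B(1) by (simp add: A_def scalar_prod_def sum_lo idx)
        ultimately show "(\<Sum>N\<in>box_deg q n. mult_coeff f M' N * B $$ (idx N, k)) = (if M' = M then 1 else 0)"
          using i k by (simp add: B(2))
      qed
    qed
  qed
qed

text \<open>All base \<open>p\<close> digits of \<open>(p ^ e - 1) div 2\<close> equal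
  \<open>(p - 1) div 2\<close>; only the last one matters for separating exponents in
  \<open>mult_inj_conic_power\<close>.\<close>

lemma half_power_mod:
  fixes p e :: nat
  assumes "odd p" "e \<ge> 1"
  shows "((p ^ e - 1) div 2) mod p = (p - 1) div 2"
  using assms(2)
proof (induction e rule: dec_induct)
  case base
  have "(p - 1) div 2 < p" using assms(1) by (cases p) auto
  then show ?case by simp
next
  case (step e)
  obtain r where r: "p = 2 * r + 1" using assms(1) by (rule oddE)
  have "odd (p ^ e)" using assms(1) by simp
  then obtain s where s: "p ^ e = 2 * s + 1" by (rule oddE)
  have "p ^ Suc e = 2 * (p * s + r) + 1" using s r by (simp add: algebra_simps)
  then have "(p ^ Suc e - 1) div 2 = p * s + r" by simp
  moreover have "(p - 1) div 2 = r" "r < p" using r by auto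
  ultimately show ?case by simp
qed

text \<open>The convention that f is a nonzero element of (x,y,z)^2 appears as
  \<open>d \<ge> 2\<close> and as the conjunct \<open>f \<noteq> 0\<close>.\<close>

theorem theoremB:
  fixes p d :: nat
  assumes "CHAR('k::field) = p" and "p > 0" and "odd p"
    and "even d" and "d \<ge> 2" and "p > d"
  shows "very_general d (\<lambda>f :: 'k poly3. f \<noteq> 0 \<and>
    (\<forall>e\<ge>1. let q = p ^ e in
      real (HK f q) = 3 / 4 * real d * (real q)\<^sup>2 - 1 / 12 * (real d ^ 3 - real d)))"
proof -
  obtain m where d: "d = 2 * m" using assms(4) by blast
  have m: "0 < m" "2 * m < p" using assms(5,6) d by auto
  define h where "h e = (p ^ e - 1) div 2" for e :: nat
  have h: "p ^ e = 2 * h e + 1" "h e mod p = (p - 1) div 2" "m \<le> h e" if "e \<ge> 1" for e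
  proof -
    have "odd (p ^ e)" using assms(3) by simp
    then show q: "p ^ e = 2 * h e + 1" by (auto simp: h_def elim: oddE)
    show mod: "h e mod p = (p - 1) div 2"
      unfolding h_def by (rule half_power_mod[OF assms(3) that])
    show "m \<le> h e" using mod_less_eq_dividend[of "h e" p] mod m(2) by simp
  qed
  define U :: "nat \<Rightarrow> 'k poly3 set"
    where "U e = {f \<in> forms d. mult_inj f (p ^ e) (3 * h e - m) (3 * h e + m)}" for e
  have det: "\<exists>g :: (3 \<Rightarrow>\<^sub>0 nat, 'k) mpoly. \<forall>f :: 'k poly3.
      (eval_mpoly (Poly_Mapping.lookup f) g \<noteq> 0 \<longleftrightarrow> mult_inj f (p ^ e) (3 * h e - m) (3 * h e + m)) \<and>
      (mult_inj f (p ^ e) (3 * h e - m) (3 * h e + m) \<longrightarrow>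
        mult_surj f (p ^ e) (3 * h e - m) (3 * h e + m))" if e: "e \<ge> 1" for e
  proof -
    have "int (card (box_deg (p ^ e) (3 * h e + m))) = int (card (box_deg (p ^ e) (3 * h e - m)))"
      using card_box_deg[of "h e" "3 * h e + m"] card_box_deg[of "h e" "3 * h e - m"] h(1,3)[OF e]
      by (simp add: of_nat_diff)
    then have "card (box_deg (p ^ e) (3 * h e + m)) = card (box_deg (p ^ e) (3 * h e - m))" by simp
    then show ?thesis by (rule mult_inj_iff_det) blast
  qed
  have "zariski_open d (U e)" if e: "e \<ge> 1" for e
  proof -
    obtain g :: "(3 \<Rightarrow>\<^sub>0 nat, 'k) mpoly" where "\<And>f :: 'k poly3.
        eval_mpoly (Poly_Mapping.lookup f) g \<noteq> 0 \<longleftrightarrow> mult_inj f (p ^ e) (3 * h e - m) (3 * h e + m)"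
      using det[OF e] by blast
    then show ?thesis
      unfolding zariski_open_def U_def by (intro exI[of _ "{g}"]) auto
  qed
  moreover have "conic ^ m \<in> U e" if e: "e \<ge> 1" for e
    using mult_inj_conic_power[OF assms(1) h(2)[OF e] assms(3) m] forms_power[OF conic_forms, of m] h(1)[OF e]
    by (simp add: U_def d)
  moreover have "f \<noteq> 0 \<and> (\<forall>e\<ge>1. let q = p ^ e in
      real (HK f q) = 3 / 4 * real d * (real q)\<^sup>2 - 1 / 12 * (real d ^ 3 - real d))"
    if f: "f \<in> forms d" "\<And>e. e \<ge> 1 \<Longrightarrow> f \<in> U e" for f :: "'k poly3"
  proof (intro conjI allI impI)
    show "f \<noteq> 0"
    proof
      assume "f = 0"
      have "mult_inj f (p ^ 1) (3 * h 1 - m) (3 * h 1 + m)" using f(2)[of 1] by (simp add: U_def)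
      moreover have "mult_coeff f M N = 0" for M N
        using \<open>f = 0\<close> by (simp add: mult_coeff_def)
      \<comment> \<open>The zero form kills the constant vector 1, which contradicts injectivity
        once a monomial of degree \<open>3 * h 1 - m\<close> is exhibited.\<close>
      ultimately have zero: "\<forall>N\<in>box_deg (p ^ 1) (3 * h 1 - m). (1 :: 'k) = 0"
        unfolding mult_inj_def by (elim allE[of _ "\<lambda>_. 1"] impE) auto
      have q: "p ^ 1 = 2 * h 1 + 1" "m \<le> h 1" using h(1,3)[of 1] by simp_all
      have "exp3 (h 1) (h 1) (h 1 - m) \<in> box_deg (p ^ 1) (3 * h 1 - m)"
        unfolding q(1) using q(2) by (auto simp: box_deg_def box_iff)
      then show False using zero by auto
    qed
  next
    fix e :: nat assume e: "e \<ge> 1"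
    let ?q = "p ^ e" and ?n = "3 * h e - m"
    have nd: "?n + d = 3 * h e + m" using h(3)[OF e] d by simp
    have inj: "mult_inj f ?q ?n (3 * h e + m)" using f(2)[OF e] by (simp add: U_def)
    then have "mult_surj f ?q ?n (3 * h e + m)" using det[OF e] by blast
    then have "HK f ?q = card (box_lt ?q (3 * h e + m)) - card (box_lt ?q ?n)"
      using HK_eq[OF f(1), of ?q ?n] inj m d h(1,3)[OF e] unfolding nd by simp
    then show "let q = p ^ e in
        real (HK f q) = 3 / 4 * real d * (real q)\<^sup>2 - 1 / 12 * (real d ^ 3 - real d)"
      using card_box_lt_diff_real[OF h(3)[OF e] d h(1)[OF e]] by (simp add: Let_def)
  qed
  moreover have "(conic ^ m :: 'k poly3) \<in> forms d"
    using forms_power[OF conic_forms, of m] d by simp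
  ultimately show ?thesis
    unfolding very_general_def
    \<comment> \<open>The index starts at 1, since \<open>m \<le> h e\<close> fails for
      \<open>e = 0\<close>. Nonemptiness comes from \<open>conic ^ m\<close>, which lies in every
      \<open>U e\<close>.\<close>
    by (intro exI[of _ "U ` {1..}"]) auto
qed

end
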